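(* For every $\pi\in B_n$, the canonical join representation of $\pi$ in the weak order on $B_n$ is the set of join-irreducible elements $j$ such that the unique arc of $\delta^\circ(j)$ is an arc of $\delta^\circ(\pi)$; i.e. the set of join-irreducibles corresponding to the arcs of $\delta^\circ(\pi)$.
   Context: $B_n$: signed permutations of $\{\pm1,\ldots,\pm n\}$ ($\pi(-i)=-\pi(i)$), long one-line notation $\pi_{-n}\cdots\pi_{-1}\pi_1\cdots\pi_n$. Weak order: $\sigma$ covers $\pi$ iff either $\pi_{-1}<\pi_1$ and $\sigma$ swaps $\pi_{-1},\pi_1$, or $\pi_i<\pi_{i+1}$ ($1\le i\le n-1$) and $\sigma$ swaps $\pi_i,\pi_{i+1}$ and $\pi_{-i-1},\pi_{-i}$; a finite lattice. Join-irreducible: covers exactly one element. Canonical join representation of $x$: the unique antichain $X$ with $\bigvee X=x$ such that for every $X'$ with $\bigvee X'=x$ the order ideal generated by $X'$ contains that generated by $X$. Symmetric model: $2n$ points labeled $-n,\ldots,-1,1,\ldots,n$ bottom to top on a vertical line, symmetric under $x\mapsto -x$. For $\pi\in B_n$, $\delta(\pi)$ has, for each pair of consecutive positions $a,b$ (order $-n<\cdots<-1<1<\cdots<n$) with $\pi_a>\pi_b$, an arc (monotone downward curve avoiding other labeled points) from $\pi_a$ to $\pi_b$ passing right of each $\pi_c$ with $\pi_b<\pi_c<\pi_a$, $c$ before $a$, and left of such $\pi_c$ with $c$ after $b$; it is centrally symmetric, a union of symmetric arcs and symmetric pairs $\{\alpha,-\alpha\}$. Orbifold model: the orbifold plane is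 $\mathbb R^2/(x\sim-x)$, pictured as the open upper half-plane plus, for each $r\ge0$, a semicircle point (closed lower semicircle of radius $r$; $r=0$ is the orbifold point $\times$); numbered points $1,\ldots,n$ lie above $\times$ on the vertical axis. Type-B arcs are ordinary arcs (between numbered points), orbifold arcs (from a numbered point down to $\times$), and long arcs (two disjoint pieces descending from distinct numbered endpoints, joined through one nondegenerate semicircle point). $\phi$ maps points above the horizontal axis to themselves, points below to their negatives, and a point $x$ on the axis to the semicircle point of radius $|x|$; it sends each symmetric arc or symmetric pair to a single type-B arc. $\delta^\circ(\pi)=\phi(\delta(\pi))$. For join-irreducible $j$, $\delta^\circ(j)$ consists of a single type-B arc, and this gives a bijection between join-irreducibles and type-B arcs. *)

theory Defs
  imports Complex_Main "HOL-Combinatorics.Permutations" "HOL-Algebra.Order"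
begin

section \<open>Signed permutations and the weak order\<close>

definition labels :: "nat \<Rightarrow> int set" where
  "labels n = {i. i \<noteq> 0 \<and> \<bar>i\<bar> \<le> int n}"

definition signed_perms :: "nat \<Rightarrow> (int \<Rightarrow> int) set" where
  "signed_perms n = {\<pi>. \<pi> permutes labels n \<and> (\<forall>i. \<pi> (- i) = - \<pi> i)}"

text \<open>\<open>weak_covered n \<pi> \<sigma>\<close>: \<open>\<sigma>\<close> covers \<open>\<pi>\<close>. The entry in position \<open>i\<close> of the long one-line
  notation is \<open>\<pi> i\<close>, so entries are swapped by composing with a transposition on the right.\<close>

definition weak_covered :: "nat \<Rightarrow> (int \<Rightarrow> int) \<Rightarrow> (int \<Rightarrow> int) \<Rightarrow> bool" where
  "weak_covered n \<pi> \<sigma> \<longleftrightarrow> \<pi> \<in> signed_perms n \<and> \<sigma> \<in> signed_perms n \<and>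
     ((\<pi> (-1) < \<pi> 1 \<and> \<sigma> = \<pi> \<circ> transpose (-1) 1) \<or>
      (\<exists>i. 1 \<le> i \<and> i \<le> int n - 1 \<and> \<pi> i < \<pi> (i + 1) \<and>
           \<sigma> = \<pi> \<circ> transpose i (i + 1) \<circ> transpose (- i - 1) (- i)))"

definition weak_order :: "nat \<Rightarrow> (int \<Rightarrow> int) gorder" where
  "weak_order n = \<lparr>carrier = signed_perms n, eq = (=), le = (weak_covered n)\<^sup>*\<^sup>*\<rparr>"

definition join_irreducible :: "nat \<Rightarrow> (int \<Rightarrow> int) \<Rightarrow> bool" where
  "join_irreducible n j \<longleftrightarrow> j \<in> signed_perms n \<and> (\<exists>!x. weak_covered n x j)"

section \<open>Canonical join representations\<close>

definition antichain_in :: "'a gorder \<Rightarrow> 'a set \<Rightarrow> bool" where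
  "antichain_in L X \<longleftrightarrow> X \<subseteq> carrier L \<and> (\<forall>x\<in>X. \<forall>y\<in>X. x \<sqsubseteq>\<^bsub>L\<^esub> y \<longrightarrow> x = y)"

definition order_ideal :: "'a gorder \<Rightarrow> 'a set \<Rightarrow> 'a set" where
  "order_ideal L X = {y \<in> carrier L. \<exists>x\<in>X. y \<sqsubseteq>\<^bsub>L\<^esub> x}"

definition canonical_join_rep :: "'a gorder \<Rightarrow> 'a \<Rightarrow> 'a set \<Rightarrow> bool" where
  "canonical_join_rep L x X \<longleftrightarrow> antichain_in L X \<and> is_lub L x X \<and>
     (\<forall>X'. X' \<subseteq> carrier L \<and> is_lub L x X' \<longrightarrow> order_ideal L X \<subseteq> order_ideal L X')"

section \<open>The symmetric model\<close>

text \<open>The plane is the complex plane, and the point labeled \<open>i\<close> is \<open>Complex 0 i\<close>. A monotone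
  curve between heights \<open>h\<close> and \<open>p\<close> is the graph of a continuous function from heights to
  horizontal coordinates; it passes right of the point labeled \<open>i\<close> iff the value at \<open>i\<close> is
  positive, and left of it iff the value is negative.\<close>

definition label_point :: "int \<Rightarrow> complex" where
  "label_point i = Complex 0 (of_int i)"

definition curve_over :: "(real \<Rightarrow> real) \<Rightarrow> int \<Rightarrow> int \<Rightarrow> complex set" where
  "curve_over f h p = (\<lambda>t. Complex (f t) t) ` {of_int h .. of_int p}"

definition descends :: "nat \<Rightarrow> int \<Rightarrow> int \<Rightarrow> (real \<Rightarrow> real) \<Rightarrow> bool" where
  "descends n p h f \<longleftrightarrow> continuous_on {of_int h .. of_int p} f \<and> f (of_int p) = 0 \<and>
     (\<forall>i\<in>labels n. h < i \<and> i < p \<longrightarrow> f (of_int i) \<noteq> 0)"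

definition descents :: "nat \<Rightarrow> (int \<Rightarrow> int) \<Rightarrow> (int \<times> int) set" where
  "descents n \<pi> = {(a, b). a \<in> labels n \<and> b \<in> labels n \<and> a < b \<and>
     (\<forall>c\<in>labels n. \<not> (a < c \<and> c < b)) \<and> \<pi> a > \<pi> b}"

definition descent_arc :: "nat \<Rightarrow> (int \<Rightarrow> int) \<Rightarrow> int \<times> int \<Rightarrow> complex set \<Rightarrow> bool" where
  "descent_arc n \<pi> = (\<lambda>(a, b) C. \<exists>f. descends n (\<pi> a) (\<pi> b) f \<and> f (of_int (\<pi> b)) = 0 \<and>
     C = curve_over f (\<pi> b) (\<pi> a) \<and>
     (\<forall>c\<in>labels n. \<pi> b < \<pi> c \<and> \<pi> c < \<pi> a \<longrightarrow>
        (c < a \<longrightarrow> f (of_int (\<pi> c)) > 0) \<and> (b < c \<longrightarrow> f (of_int (\<pi> c)) < 0)))"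

text \<open>The diagram \<open>\<delta>(\<pi>)\<close> is determined only up to moving its arcs without changing their
  endpoints and the side on which they pass each labeled point. \<open>symmetric_diagram n \<pi> D\<close> says
  that the set of curves \<open>D\<close> is a noncrossing, centrally symmetric drawing of it.\<close>

definition symmetric_diagram :: "nat \<Rightarrow> (int \<Rightarrow> int) \<Rightarrow> complex set set \<Rightarrow> bool" where
  "symmetric_diagram n \<pi> D \<longleftrightarrow>
     (\<exists>K. (\<forall>d\<in>descents n \<pi>. descent_arc n \<pi> d (K d)) \<and> D = K ` descents n \<pi>) \<and>
     (\<forall>C\<in>D. uminus ` C \<in> D) \<and>
     (\<forall>C\<in>D. \<forall>C'\<in>D. C \<noteq> C' \<longrightarrow> C \<inter> C' \<subseteq> label_point ` labels n)"

section \<open>The orbifold model\<close>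

text \<open>Points of the orbifold plane: \<open>Upper_pt z\<close> with \<open>Im z > 0\<close>, and \<open>Semicircle_pt r\<close> with
  \<open>r \<ge> 0\<close>; the orbifold point is \<open>Semicircle_pt 0\<close>.\<close>

datatype orbifold_point = Upper_pt complex | Semicircle_pt real

definition orbifold_proj :: "complex \<Rightarrow> orbifold_point" where
  "orbifold_proj z = (if Im z > 0 then Upper_pt z else if Im z < 0 then Upper_pt (- z)
     else Semicircle_pt \<bar>Re z\<bar>)"

lemma orbifold_proj_eq_iff: "orbifold_proj z = orbifold_proj w \<longleftrightarrow> w = z \<or> w = - z"
  by (auto simp: orbifold_proj_def complex_eq_iff abs_if split: if_splits)

lemma range_orbifold_proj:
  "range orbifold_proj = Upper_pt ` {z. Im z > 0} \<union> Semicircle_pt ` {r. r \<ge> 0}"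
proof (intro equalityI subsetI)
  fix x assume "x \<in> Upper_pt ` {z. Im z > 0} \<union> Semicircle_pt ` {r. r \<ge> 0}"
  then consider z where "x = Upper_pt z" "Im z > 0" | r where "x = Semicircle_pt r" "r \<ge> 0"
    by auto
  then show "x \<in> range orbifold_proj"
  proof cases
    case 1
    then have "x = orbifold_proj z" by (simp add: orbifold_proj_def)
    then show ?thesis by simp
  next
    case 2
    then have "x = orbifold_proj (Complex r 0)" by (simp add: orbifold_proj_def)
    then show ?thesis by simp
  qed
qed (auto simp: orbifold_proj_def)

text \<open>The predicates below say that the set \<open>B\<close> of orbifold points is a type-B arc of the given
  kind, with the functions \<open>f\<close>, \<open>g\<close> describing its pieces. Over nonnegative heights
  \<open>orbifold_proj\<close> changes nothing except that a piece that reaches height \<open>0\<close> ends in a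
  semicircle point.\<close>

definition ordinary_arc ::
    "nat \<Rightarrow> int \<Rightarrow> int \<Rightarrow> (real \<Rightarrow> real) \<Rightarrow> orbifold_point set \<Rightarrow> bool" where
  "ordinary_arc n p q f B \<longleftrightarrow> 1 \<le> q \<and> q < p \<and> p \<le> int n \<and>
     descends n p q f \<and> f (of_int q) = 0 \<and> B = orbifold_proj ` curve_over f q p"

definition orbifold_arc ::
    "nat \<Rightarrow> int \<Rightarrow> (real \<Rightarrow> real) \<Rightarrow> orbifold_point set \<Rightarrow> bool" where
  "orbifold_arc n p f B \<longleftrightarrow> 1 \<le> p \<and> p \<le> int n \<and>
     descends n p 0 f \<and> f 0 = 0 \<and> B = orbifold_proj ` curve_over f 0 p"

text \<open>The pieces of a long arc arrive at the two opposite ends of one nondegenerate semicircle,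
  so that the whole arc traverses the semicircle: hence \<open>g 0 = - f 0 \<noteq> 0\<close>. Pieces are named so
  that \<open>f\<close> starts at the higher endpoint \<open>p\<close>.\<close>

definition long_arc ::
    "nat \<Rightarrow> int \<Rightarrow> int \<Rightarrow> (real \<Rightarrow> real) \<Rightarrow> (real \<Rightarrow> real) \<Rightarrow> orbifold_point set \<Rightarrow> bool" where
  "long_arc n p q f g B \<longleftrightarrow> 1 \<le> q \<and> q < p \<and> p \<le> int n \<and>
     descends n p 0 f \<and> descends n q 0 g \<and> f 0 \<noteq> 0 \<and> g 0 = - f 0 \<and>
     curve_over f 0 p \<inter> curve_over g 0 q = {} \<and>
     B = orbifold_proj ` curve_over f 0 p \<union> orbifold_proj ` curve_over g 0 q"

text \<open>Two type-B arcs represent the same arc iff they are of the same kind, have the same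
  endpoints, and corresponding pieces pass on the same side of every numbered point.\<close>

definition same_sides :: "nat \<Rightarrow> int \<Rightarrow> int \<Rightarrow> (real \<Rightarrow> real) \<Rightarrow> (real \<Rightarrow> real) \<Rightarrow> bool" where
  "same_sides n p h f f' \<longleftrightarrow>
     (\<forall>i\<in>labels n. h < i \<and> i < p \<longrightarrow> sgn (f (of_int i)) = sgn (f' (of_int i)))"

definition type_B_arc_equiv :: "nat \<Rightarrow> (orbifold_point set \<times> orbifold_point set) set" where
  "type_B_arc_equiv n = {(B, B').
     (\<exists>p q f f'. ordinary_arc n p q f B \<and> ordinary_arc n p q f' B' \<and> same_sides n p q f f') \<or>
     (\<exists>p f f'. orbifold_arc n p f B \<and> orbifold_arc n p f' B' \<and> same_sides n p 0 f f') \<or>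
     (\<exists>p q f f' g g'. long_arc n p q f g B \<and> long_arc n p q f' g' B' \<and>
        same_sides n p 0 f f' \<and> same_sides n q 0 g g')}"

text \<open>\<open>\<delta>\<^sup>\<circ>(\<pi>) = \<phi>(\<delta>(\<pi>))\<close>, as a set of equivalence classes of type-B arcs. The choice of the
  symmetric drawing does not affect the classes, so all drawings may contribute.\<close>

definition orbifold_diagram :: "nat \<Rightarrow> (int \<Rightarrow> int) \<Rightarrow> orbifold_point set set set" where
  "orbifold_diagram n \<pi> =
     {type_B_arc_equiv n `` {orbifold_proj ` C} | C. \<exists>D. symmetric_diagram n \<pi> D \<and> C \<in> D}"

end

theory Submission
  imports Defs
begin

text \<open>The weak order is containment of inversion sets, and every inversion of a signed permutation
  is obtained by transitivity from those that cross one descent. Hence an element that inverts the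
  two values of a descent of \<open>\<pi>\<close>, and lies below \<open>\<pi>\<close>, is above the join-irreducible with the same
  arc, whereas an element below \<open>\<pi>\<close> that does not invert them is below the corresponding lower
  cover of \<open>\<pi>\<close>. This makes the join-irreducibles of the arcs of \<open>\<pi>\<close> its canonical joinands. On the
  geometric side, the kind, endpoints and sides of a type-B arc can be recovered from its point set,
  and a symmetric noncrossing drawing is obtained by placing the arcs from left to right in the
  order of the descents.\<close>

section \<open>Inversions\<close>

text \<open>Both halves meet in the finite set \<open>arcs\<close>, whose triples consist of the
  upper value of a descent, its lower value, and the intermediate values that stand before it. The
  combinatorial half characterizes the canonical joinands by inclusion of \<open>arcs\<close>; the
  geometric half matches triples with classes of point sets. Two obstacles shape the latter. The
  relation \<open>type_B_arc_equiv\<close> speaks of bare point sets through existentially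
  quantified functions, so one set might a priori be described in several ways; for long arcs, where
  each low height carries two points, the pieces have to be told apart. Moreover
  \<open>orbifold_diagram\<close> collects the arcs of all drawings, so it has content only once
  some drawing is known to exist. On the combinatorial side everything is invariant under the
  half-turn: descents come in mirror pairs, and a central descent, which is its own mirror image,
  has to fit the same formulas.\<close>

lemma finite_labels: "finite (labels n)"
  by (rule finite_subset[of _ "{- int n..int n}"]) (auto simp: labels_def)

lemma uminus_labels_iff [simp]: "- i \<in> labels n \<longleftrightarrow> i \<in> labels n"
  by (auto simp: labels_def)

lemma signed_perms_uminus: "\<sigma> \<in> signed_perms n \<Longrightarrow> \<sigma> (- i) = - \<sigma> i"
  by (simp add: signed_perms_def)

lemma signed_perms_permutes: "\<sigma> \<in> signed_perms n \<Longrightarrow> \<sigma> permutes labels n"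
  by (simp add: signed_perms_def)

lemma signed_perms_bij: "\<sigma> \<in> signed_perms n \<Longrightarrow> bij \<sigma>"
  by (rule permutes_bij[OF signed_perms_permutes])

lemma signed_perms_in_labels: "\<sigma> \<in> signed_perms n \<Longrightarrow> \<sigma> i \<in> labels n \<longleftrightarrow> i \<in> labels n"
  by (rule permutes_in_image[OF signed_perms_permutes])

lemma signed_perms_inverses:
  assumes "\<sigma> \<in> signed_perms n"
  shows "inv \<sigma> (\<sigma> i) = i" "\<sigma> (inv \<sigma> i) = i"
  using permutes_inverses[OF signed_perms_permutes[OF assms]] by simp_all

lemma signed_perms_eq_iff: "\<sigma> \<in> signed_perms n \<Longrightarrow> \<sigma> i = \<sigma> j \<longleftrightarrow> i = j"
  by (rule inj_eq[OF bij_is_inj[OF signed_perms_bij]])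

lemmas signed_perms_simps = signed_perms_in_labels signed_perms_inverses signed_perms_eq_iff

lemma signed_perms_inv:
  assumes "\<sigma> \<in> signed_perms n"
  shows "inv \<sigma> \<in> signed_perms n"
proof -
  have "inv \<sigma> (- i) = - inv \<sigma> i" for i
    using signed_perms_inverses(1)[OF assms, of "- inv \<sigma> i"]
    by (simp add: signed_perms_uminus[OF assms] signed_perms_inverses(2)[OF assms])
  then show ?thesis
    using permutes_inv[OF signed_perms_permutes[OF assms]] by (simp add: signed_perms_def)
qed

lemma signed_perms_inv_uminus: "\<sigma> \<in> signed_perms n \<Longrightarrow> inv \<sigma> (- i) = - inv \<sigma> i"
  by (rule signed_perms_uminus[OF signed_perms_inv])

lemma signed_perms_comp:
  "\<lbrakk>\<sigma> \<in> signed_perms n; \<tau> \<in> signed_perms n\<rbrakk> \<Longrightarrow> \<sigma> \<circ> \<tau> \<in> signed_perms n"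
  by (auto simp: signed_perms_def intro: permutes_compose)

text \<open>Pairs of values rather than of positions: a cover composes with transpositions of
  neighbouring positions on the right, so it changes the relative order of one pair of values and
  its mirror image only.\<close>

definition inversions :: "nat \<Rightarrow> (int \<Rightarrow> int) \<Rightarrow> (int \<times> int) set" where
  "inversions n \<sigma> = {(x, z). x \<in> labels n \<and> z \<in> labels n \<and> x < z \<and> inv \<sigma> z < inv \<sigma> x}"

lemma finite_inversions: "finite (inversions n \<sigma>)"
  by (rule finite_subset[of _ "labels n \<times> labels n"]) (auto simp: inversions_def finite_labels)

lemma inversions_uminus:
  assumes "\<sigma> \<in> signed_perms n"
  shows "(- z, - x) \<in> inversions n \<sigma> \<longleftrightarrow> (x, z) \<in> inversions n \<sigma>"
  using assms by (auto simp: inversions_def signed_perms_inv_uminus)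

lemma inv_less_of_inversions_subset:
  assumes "\<sigma> \<in> signed_perms n" "inversions n \<sigma> \<subseteq> inversions n \<tau>" "x \<in> labels n" "z \<in> labels n"
    and "x < z" "inv \<tau> x < inv \<tau> z"
  shows "inv \<sigma> x < inv \<sigma> z"
proof (rule ccontr)
  assume "\<not> inv \<sigma> x < inv \<sigma> z"
  moreover have "inv \<sigma> x \<noteq> inv \<sigma> z"
    using assms(5) signed_perms_eq_iff[OF signed_perms_inv[OF assms(1)]] by simp
  ultimately have "(x, z) \<in> inversions n \<sigma>"
    using assms by (simp add: inversions_def)
  then show False
    using assms by (auto simp: inversions_def)
qed

text \<open>With equal inversion sets, \<open>inv \<sigma> \<circ> \<tau>\<close> preserves the
  order of positions, and an order-preserving permutation of a finite chain is the identity.\<close>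

lemma inversions_inj:
  assumes "\<sigma> \<in> signed_perms n" "\<tau> \<in> signed_perms n" "inversions n \<sigma> = inversions n \<tau>"
  shows "\<sigma> = \<tau>"
proof -
  define h where "h i = inv \<sigma> (\<tau> i)" for i
  have iff: "inv \<sigma> x < inv \<sigma> z \<longleftrightarrow> inv \<tau> x < inv \<tau> z" if "x < z" "x \<in> labels n" "z \<in> labels n" for x z
    using inv_less_of_inversions_subset[OF assms(1) _ that(2,3,1)]
      inv_less_of_inversions_subset[OF assms(2) _ that(2,3,1)] assms(3) by blast
  have mono: "h i < h j" if "i < j" "i \<in> labels n" "j \<in> labels n" for i j
  proof (cases "\<tau> i < \<tau> j")
    case True
    then show ?thesis using iff[of "\<tau> i" "\<tau> j"] that by (simp add: h_def signed_perms_simps[OF assms(2)])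
  next
    case False
    then have "\<tau> j < \<tau> i" using that assms by (simp add: less_le linorder_not_less signed_perms_simps[OF assms(2)])
    then have "\<not> h j < h i"
      using iff[of "\<tau> j" "\<tau> i"] that by (simp add: h_def signed_perms_simps[OF assms(2)])
    moreover have "h i \<noteq> h j" 
      using that by (simp add: h_def signed_perms_eq_iff[OF assms(2)]
        signed_perms_eq_iff[OF signed_perms_inv[OF assms(1)]])
    ultimately show ?thesis by simp
  qed
  have perm: "h permutes labels n"
    using signed_perms_comp[OF signed_perms_inv[OF assms(1)] assms(2)]
    by (auto simp: h_def[abs_def] signed_perms_def comp_def)
  \<comment> \<open>\<open>h\<close> maps the labels below \<open>i\<close> onto the labels below
    \<open>h i\<close>; as the number of smaller labels determines a label,
    \<open>h i = i\<close>.\<close>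
  have fixed: "h i = i" if "i \<in> labels n" for i
  proof -
    have "card {j \<in> labels n. j < i} = card (h ` {j \<in> labels n. j < i})"
      using permutes_inj_on[OF perm] by (simp add: card_image)
    moreover have "h ` {j \<in> labels n. j < i} = {j \<in> labels n. j < h i}"
    proof (intro equalityI subsetI)
      fix k assume "k \<in> {j \<in> labels n. j < h i}"
      then obtain j where "k = h j" "j \<in> labels n" "h j < h i"
        using permutes_image[OF perm] by (smt (verit) imageE mem_Collect_eq)
      moreover then have "j < i" using mono[of i j] that by (cases "i = j"; cases "i < j") auto
      ultimately show "k \<in> h ` {j \<in> labels n. j < i}" by blast
    qed (use mono that perm in \<open>auto simp: permutes_in_image\<close>)
    ultimately have eq: "card {j \<in> labels n. j < i} = card {j \<in> labels n. j < h i}" by simp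
    have strict: "card {j \<in> labels n. j < k} < card {j \<in> labels n. j < l}"
      if "k < l" "k \<in> labels n" for k l
      by (rule psubset_card_mono) (use that in \<open>auto simp: finite_labels\<close>)
    have "h i \<in> labels n" using perm that by (simp add: permutes_in_image)
    then have "\<not> i < h i" "\<not> h i < i"
      using strict[of i "h i"] strict[of "h i" i] eq that by auto
    then show ?thesis by simp
  qed
  have "inv \<sigma> (\<tau> i) = i" for i
    using fixed[of i] permutes_not_in[OF perm, of i] by (cases "i \<in> labels n") (simp_all add: h_def)
  then have "\<sigma> i = \<tau> i" for i
    using signed_perms_inverses(2)[OF assms(1), of "\<tau> i"] by simp
  then show ?thesis by blast
qed

lemma descents_consecutive:
  assumes "(a, b) \<in> descents n \<sigma>" "c \<in> labels n"
  shows "c \<le> a \<or> b \<le> c"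
  using assms by (auto simp: descents_def not_less)

text \<open>If \<open>z\<close> stands before \<open>x\<close> and no value in between occurs between their positions, the last
  entry \<open>\<ge> z\<close> before \<open>x\<close> starts a descent that passes from above \<open>z\<close> to below \<open>x\<close>; the
  remaining inversions follow by transitivity.\<close>

lemma inversions_subsetI:
  assumes \<tau>: "\<tau> \<in> signed_perms n"
    and H: "\<And>a b x z. \<lbrakk>(a, b) \<in> descents n \<tau>; x \<in> labels n; z \<in> labels n; \<tau> b \<le> x; x < z; z \<le> \<tau> a;
      inv \<tau> z \<le> a; b \<le> inv \<tau> x\<rbrakk> \<Longrightarrow> inv \<upsilon> z < inv \<upsilon> x"
  shows "inversions n \<tau> \<subseteq> inversions n \<upsilon>"
proof -
  have claim: "inv \<upsilon> (\<tau> a) < inv \<upsilon> (\<tau> b)"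
    if "a < b" "a \<in> labels n" "b \<in> labels n" "\<tau> b < \<tau> a" for a b
    using that
  proof (induction "nat (b - a)" arbitrary: a b rule: less_induct)
    case less
    show ?case
    proof (cases "\<exists>c\<in>labels n. a < c \<and> c < b \<and> \<tau> b < \<tau> c \<and> \<tau> c < \<tau> a")
      \<comment> \<open>An intermediate value at an intermediate position splits the pair into two
        closer ones, whose inversions compose.\<close>
      case True
      then obtain c where "c \<in> labels n" "a < c" "c < b" "\<tau> b < \<tau> c" "\<tau> c < \<tau> a" by blast
      then show ?thesis
        using less.hyps[of c a] less.hyps[of b c] less.prems by fastforce
    next
      case False
      define S where "S = {c \<in> labels n. a \<le> c \<and> c < b \<and> \<tau> a \<le> \<tau> c}"
      define c where "c = Max S"
      have "finite S" "a \<in> S" using less.prems finite_labels by (auto simp: S_def)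
      then have c: "c \<in> S" and c_max: "\<And>e. e \<in> S \<Longrightarrow> e \<le> c"
        unfolding c_def by (auto intro: Max_in)
      \<comment> \<open>\<open>c'\<close> is the position right after \<open>c\<close>, taken as a
        minimum because the labels skip 0.\<close>
      define T where "T = {e \<in> labels n. c < e}"
      define c' where "c' = Min T"
      have "finite T" "b \<in> T" using less.prems finite_labels c by (auto simp: T_def S_def)
      then have c': "c' \<in> T" and c'_min: "\<And>e. e \<in> T \<Longrightarrow> c' \<le> e"
        unfolding c'_def by (auto intro: Min_in)
      have "c' \<le> b" using c'_min \<open>b \<in> T\<close> by blast
      \<comment> \<open>If \<open>c'\<close> lies before \<open>b\<close>, maximality of
        \<open>c\<close> gives \<open>\<tau> c' < \<tau> a\<close>, and no value strictly between
        \<open>\<tau> b\<close> and \<open>\<tau> a\<close> occurs there.\<close>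
      have "\<tau> c' \<le> \<tau> b"
      proof (cases "c' = b")
        case False
        then have "c' \<notin> S" using c_max c' by (force simp: T_def)
        then have "\<tau> c' < \<tau> a" using False c c' \<open>c' \<le> b\<close> by (auto simp: S_def T_def)
        then show ?thesis
          using False \<open>\<not> (\<exists>c\<in>labels n. _ c)\<close> c c' \<open>c' \<le> b\<close> by (force simp: S_def T_def)
      qed simp
      moreover have "(c, c') \<in> descents n \<tau>"
        using c c' c'_min \<open>\<tau> c' \<le> \<tau> b\<close> less.prems by (force simp: descents_def S_def T_def)
      ultimately show ?thesis
        using H[of c c' "\<tau> b" "\<tau> a"] less.prems c \<open>c' \<le> b\<close>
        by (simp add: S_def signed_perms_simps[OF \<tau>])
    qed
  qed
  show ?thesis
  proof
    fix y assume "y \<in> inversions n \<tau>"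
    then obtain x z where "y = (x, z)" "x \<in> labels n" "z \<in> labels n" "x < z" "inv \<tau> z < inv \<tau> x"
      by (auto simp: inversions_def)
    then show "y \<in> inversions n \<upsilon>"
      using claim[of "inv \<tau> z" "inv \<tau> x"]
      by (simp add: inversions_def signed_perms_simps[OF \<tau>] signed_perms_simps[OF signed_perms_inv[OF \<tau>]])
  qed
qed

text \<open>In \<open>\<tau>\<close> the values \<open>z\<close> and \<open>\<tau> a\<close> stand
  in increasing order (or coincide), and so do \<open>\<tau> b\<close> and \<open>x\<close>. Pairs
  not inverted in \<open>\<tau>\<close> are not inverted in \<open>\<sigma>\<close>, so
  \<open>\<sigma>\<close> places these values in the order \<open>z\<close>,
  \<open>\<tau> a\<close>, \<open>\<tau> b\<close>, \<open>x\<close>. Inverting one descent thus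
  forces every inversion that crosses it.\<close>

lemma inversions_subset_of_descents:
  assumes "\<sigma> \<in> signed_perms n" "\<tau> \<in> signed_perms n" "inversions n \<sigma> \<subseteq> inversions n \<tau>"
    and "(a, b) \<in> descents n \<tau>" "inv \<sigma> (\<tau> a) < inv \<sigma> (\<tau> b)"
    and "x \<in> labels n" "z \<in> labels n" "\<tau> b \<le> x" "z \<le> \<tau> a" "inv \<tau> z \<le> a" "b \<le> inv \<tau> x"
  shows "inv \<sigma> z < inv \<sigma> x"
proof -
  have ab: "a \<in> labels n" "b \<in> labels n" using assms by (auto simp: descents_def)
  have "inv \<sigma> z \<le> inv \<sigma> (\<tau> a)"
  proof (cases "z = \<tau> a")
    case False
    then have "inv \<tau> z \<noteq> a" using signed_perms_inverses(2)[OF assms(2), of z] by auto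
    then show ?thesis
      using inv_less_of_inversions_subset[OF assms(1,3), of z "\<tau> a"] assms(6-) ab False
        by (simp add: signed_perms_simps[OF assms(2)])
  qed simp
  moreover have "inv \<sigma> (\<tau> b) \<le> inv \<sigma> x"
  proof (cases "x = \<tau> b")
    case False
    then have "inv \<tau> x \<noteq> b" using signed_perms_inverses(2)[OF assms(2), of x] by auto
    then show ?thesis
      using inv_less_of_inversions_subset[OF assms(1,3), of "\<tau> b" x] assms(6-) ab False
        by (simp add: signed_perms_simps[OF assms(2)])
  qed simp
  ultimately show ?thesis using assms(5) by linarith
qed

section \<open>Lower covers and join-irreducibles\<close>

lemma descents_uminus:
  assumes "\<sigma> \<in> signed_perms n"
  shows "(- b, - a) \<in> descents n \<sigma> \<longleftrightarrow> (a, b) \<in> descents n \<sigma>"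
proof -
  have "(\<forall>c\<in>labels n. \<not> (- b < c \<and> c < - a)) \<longleftrightarrow> (\<forall>c\<in>labels n. \<not> (a < c \<and> c < b))"
    by (metis minus_less_iff minus_minus neg_less_iff_less uminus_labels_iff)
  then show ?thesis
    by (auto simp: descents_def signed_perms_uminus[OF assms])
qed

lemma descents_cases:
  assumes "(a, b) \<in> descents n \<sigma>"
  obtains "a = -1" "b = 1" | "b = a + 1" "1 \<le> a" | "b = a + 1" "b \<le> -1"
proof -
  have ab: "a \<in> labels n" "b \<in> labels n" "a < b" using assms by (auto simp: descents_def)
  consider "a = -1" | "a + 1 \<in> labels n" using ab by (fastforce simp: labels_def)
  then show ?thesis
  proof cases
    case 1
    then have "1 \<in> labels n" using ab(1) by (simp add: labels_def)
    then have "b = 1" using descents_consecutive[OF assms, of 1] ab 1 by (auto simp: labels_def)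
    then show ?thesis using 1 that(1) by blast
  next
    case 2
    then have "b = a + 1" using descents_consecutive[OF assms 2] ab by auto
    then show ?thesis using that(2,3) ab by (fastforce simp: labels_def)
  qed
qed

text \<open>For a central descent the two transpositions coincide and their product would be the
  identity, hence the case distinction.\<close>

definition flip :: "int \<Rightarrow> int \<Rightarrow> int \<Rightarrow> int" where
  "flip a b = (if a = - b then transpose a b else transpose a b \<circ> transpose (- b) (- a))"

lemma flip_apply:
  assumes "a \<noteq> 0" "b \<noteq> 0" "a \<noteq> b"
  shows "flip a b i =
    (if i = a then b else if i = b then a else if i = - a then - b else if i = - b then - a else i)"
  using assms by (cases "a = - b") (simp_all add: flip_def transpose_def)

lemma flip_uminus: "a \<noteq> 0 \<Longrightarrow> b \<noteq> 0 \<Longrightarrow> a \<noteq> b \<Longrightarrow> flip a b (- i) = - flip a b i"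
  by (simp add: flip_apply minus_equation_iff[of i] eq_commute[of _ i])

lemma flip_flip: "a \<noteq> 0 \<Longrightarrow> b \<noteq> 0 \<Longrightarrow> a \<noteq> b \<Longrightarrow> flip a b (flip a b i) = i"
  by (simp add: flip_apply)

lemma flip_mirror: "a \<noteq> 0 \<Longrightarrow> b \<noteq> 0 \<Longrightarrow> a \<noteq> b \<Longrightarrow> flip (- b) (- a) = flip a b"
  by (rule ext) (simp add: flip_apply)

lemma flip_signed_perms:
  assumes "a \<in> labels n" "b \<in> labels n" "a \<noteq> b"
  shows "flip a b \<in> signed_perms n"
proof -
  have "flip a b permutes labels n"
    using assms by (auto simp: flip_def intro!: permutes_compose permutes_swap_id)
  moreover have "flip a b (- i) = - flip a b i" for i
    using assms by (intro flip_uminus) (auto simp: labels_def)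
  ultimately show ?thesis by (simp add: signed_perms_def)
qed

text \<open>Neighbouring positions exchange their order with each other only. Position 0 is excluded
  because it lies between -1 and 1, which the central flip exchanges.\<close>

lemma flip_less_iff:
  assumes "(a, b) \<in> descents n \<sigma>" "s \<noteq> 0" "t \<noteq> 0"
  shows "flip a b s < flip a b t \<longleftrightarrow>
    (s < t \<and> \<not> (s = a \<and> t = b) \<and> \<not> (s = - b \<and> t = - a)) \<or> (s = b \<and> t = a) \<or> (s = - a \<and> t = - b)"
  using assms(1)
proof (cases rule: descents_cases)
  case 1
  then show ?thesis using assms(2,3) by (auto simp: flip_apply)
next
  case 2
  then show ?thesis using assms(2,3) by (simp add: flip_apply) (smt (verit))
next
  case 3
  then show ?thesis using assms(2,3) by (simp add: flip_apply) (smt (verit))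
qed

lemma descents_swap_signed_perms:
  assumes "\<tau> \<in> signed_perms n" "(a, b) \<in> descents n \<tau>"
  shows "\<tau> \<circ> flip a b \<in> signed_perms n"
  using assms by (intro signed_perms_comp flip_signed_perms) (auto simp: descents_def)

lemma inversions_swap:
  assumes \<tau>: "\<tau> \<in> signed_perms n" and ab: "(a, b) \<in> descents n \<tau>"
  shows "inversions n (\<tau> \<circ> flip a b) = inversions n \<tau> - {(\<tau> b, \<tau> a), (- \<tau> a, - \<tau> b)}"
proof -
  have nz: "a \<noteq> 0" "b \<noteq> 0" "a \<noteq> b" and gt: "\<tau> b < \<tau> a"
    and lab: "a \<in> labels n" "b \<in> labels n" using ab by (auto simp: descents_def labels_def)
  have "inv (flip a b) = flip a b"
    by (rule inv_equality) (auto simp: flip_flip nz)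
  then have inv: "inv (\<tau> \<circ> flip a b) v = flip a b (inv \<tau> v)" for v
    using o_inv_distrib[OF signed_perms_bij[OF \<tau>] signed_perms_bij[OF flip_signed_perms[OF lab nz(3)]]]
    by simp
  have inv_eq: "inv \<tau> v = c \<longleftrightarrow> v = \<tau> c" for v c
    using signed_perms_inverses(1)[OF \<tau>, of c] signed_perms_inverses(2)[OF \<tau>, of v] by auto
  have inv_nz: "inv \<tau> v \<noteq> 0" if "v \<in> labels n" for v
    using that signed_perms_in_labels[OF signed_perms_inv[OF \<tau>], of v] by (auto simp: labels_def)
  have "(x, z) \<in> inversions n (\<tau> \<circ> flip a b) \<longleftrightarrow>
      (x, z) \<in> inversions n \<tau> - {(\<tau> b, \<tau> a), (- \<tau> a, - \<tau> b)}"
    if "x \<in> labels n" "z \<in> labels n" for x z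
  proof -
    have "flip a b (inv \<tau> z) < flip a b (inv \<tau> x) \<longleftrightarrow>
      (inv \<tau> z < inv \<tau> x \<and> \<not> (z = \<tau> a \<and> x = \<tau> b) \<and> \<not> (z = - \<tau> b \<and> x = - \<tau> a)) \<or>
      (z = \<tau> b \<and> x = \<tau> a) \<or> (z = - \<tau> a \<and> x = - \<tau> b)"
      using flip_less_iff[OF ab inv_nz[OF that(2)] inv_nz[OF that(1)]]
      by (simp only: inv_eq signed_perms_uminus[OF \<tau>])
    moreover have "\<not> (z = \<tau> b \<and> x = \<tau> a)" "\<not> (z = - \<tau> a \<and> x = - \<tau> b)" if "x < z"
      using that gt by auto
    ultimately show ?thesis
      unfolding inversions_def mem_Collect_eq case_prod_conv inv Diff_iff insert_iff empty_iff prod.inject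
      by blast
  qed
  then show ?thesis by (auto simp: inversions_def)
qed

lemma descents_in_inversions:
  assumes "\<tau> \<in> signed_perms n" "(a, b) \<in> descents n \<tau>"
  shows "(\<tau> b, \<tau> a) \<in> inversions n \<tau>"
  using assms(2) by (auto simp: inversions_def descents_def signed_perms_simps[OF assms(1)])

text \<open>The definition reads a cover from below, through an ascent of the lower element; the
  later arguments go down from a given element and need its descents. The condition
  \<open>0 \<le> a + b\<close> selects one descent of each mirror pair.\<close>

lemma weak_covered_iff:
  "weak_covered n x \<tau> \<longleftrightarrow> \<tau> \<in> signed_perms n \<and>
     (\<exists>a b. (a, b) \<in> descents n \<tau> \<and> 0 \<le> a + b \<and> x = \<tau> \<circ> flip a b)"
proof
  assume cov: "weak_covered n x \<tau>"
  then have \<tau>: "\<tau> \<in> signed_perms n" and x: "x \<in> signed_perms n"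
    unfolding weak_covered_def by blast+
  have unflip: "x = \<tau> \<circ> flip a b" if "\<tau> = x \<circ> flip a b" "a \<noteq> 0" "b \<noteq> 0" "a \<noteq> b" for a b
    unfolding that(1) by (rule ext) (simp add: flip_flip[OF that(2-4)])
  from cov consider "x (- 1) < x 1" "\<tau> = x \<circ> transpose (-1) 1"
    | i where "1 \<le> i" "i \<le> int n - 1" "x i < x (i + 1)"
        "\<tau> = x \<circ> transpose i (i + 1) \<circ> transpose (- i - 1) (- i)"
    unfolding weak_covered_def by blast
  then show "\<tau> \<in> signed_perms n \<and>
     (\<exists>a b. (a, b) \<in> descents n \<tau> \<and> 0 \<le> a + b \<and> x = \<tau> \<circ> flip a b)"
  proof cases
    case 1
    have vals: "\<tau> 1 = x (- 1)" "\<tau> (- 1) = x 1" unfolding 1(2) by simp_all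
    \<comment> \<open>For \<open>n = 0\<close> the swap would move points outside
      \<open>labels n\<close>.\<close>
    have "1 \<in> labels n"
    proof (rule ccontr)
      assume "1 \<notin> labels n"
      then have "\<tau> 1 = 1" "x 1 = 1"
        by (simp_all add: permutes_not_in[OF signed_perms_permutes[OF \<tau>]]
          permutes_not_in[OF signed_perms_permutes[OF x]])
      then show False using vals signed_perms_uminus[OF \<tau>, of 1] by simp
    qed
    then have "(-1, 1) \<in> descents n \<tau>"
      using 1(1) vals by (auto simp: descents_def labels_def)
    moreover have "\<tau> = x \<circ> flip (-1) 1" using 1(2) by (simp add: flip_def)
    ultimately show ?thesis using unflip[of "-1" 1] \<tau> by force
  next
    case 2
    have eq: "\<tau> = x \<circ> flip i (i + 1)"
      using 2(1,4) by (auto simp: flip_def fun_eq_iff)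
    have "\<tau> i = x (i + 1)" "\<tau> (i + 1) = x i"
      unfolding eq using 2(1) by (simp_all add: flip_def transpose_def)
    then have "(i, i + 1) \<in> descents n \<tau>"
      using 2(1-3) by (simp add: descents_def labels_def)
    then show ?thesis using unflip[OF eq] \<tau> 2(1) by force
  qed
next
  assume "\<tau> \<in> signed_perms n \<and>
     (\<exists>a b. (a, b) \<in> descents n \<tau> \<and> 0 \<le> a + b \<and> x = \<tau> \<circ> flip a b)"
  then obtain a b where \<tau>: "\<tau> \<in> signed_perms n" and ab: "(a, b) \<in> descents n \<tau>" "0 \<le> a + b"
    and x: "x = \<tau> \<circ> flip a b" by blast
  have nz: "a \<noteq> 0" "b \<noteq> 0" "a \<noteq> b" and gt: "\<tau> b < \<tau> a" and "\<bar>b\<bar> \<le> int n"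
    using ab by (auto simp: descents_def labels_def)
  have undo: "\<tau> = x \<circ> flip a b"
    unfolding x by (rule ext) (simp add: flip_flip[OF nz])
  have "x \<in> signed_perms n" using descents_swap_signed_perms[OF \<tau> ab(1)] x by simp
  moreover from ab(1) have "(x (-1) < x 1 \<and> \<tau> = x \<circ> transpose (-1) 1) \<or>
      (\<exists>i. 1 \<le> i \<and> i \<le> int n - 1 \<and> x i < x (i + 1) \<and>
           \<tau> = x \<circ> transpose i (i + 1) \<circ> transpose (- i - 1) (- i))"
  proof (cases rule: descents_cases)
    case 1
    then have "x (-1) < x 1" using gt unfolding x by (simp add: flip_def)
    moreover have "\<tau> = x \<circ> transpose (-1) 1" using undo 1 by (simp add: flip_def)
    ultimately show ?thesis by blast
  next
    case 2
    have "x a < x (a + 1)"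
      unfolding x using 2 gt by (simp add: flip_def transpose_def)
    moreover have "\<tau> = x \<circ> transpose a (a + 1) \<circ> transpose (- a - 1) (- a)"
      by (subst undo) (use 2 in \<open>simp add: flip_def comp_assoc\<close>)
    moreover have "a \<le> int n - 1" using 2 \<open>\<bar>b\<bar> \<le> int n\<close> by simp
    ultimately show ?thesis using 2(2) by blast
  qed (use ab in auto)
  ultimately show "weak_covered n x \<tau>" using \<tau> unfolding weak_covered_def by blast
qed

lemma weak_covered_swap:
  assumes "\<tau> \<in> signed_perms n" "(a, b) \<in> descents n \<tau>"
  shows "weak_covered n (\<tau> \<circ> flip a b) \<tau>"
proof (cases "0 \<le> a + b")
  case False
  have "flip (- b) (- a) = flip a b"
    using assms(2) by (intro flip_mirror) (auto simp: descents_def labels_def)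
  then have "(- b, - a) \<in> descents n \<tau> \<and> 0 \<le> - b + - a \<and> \<tau> \<circ> flip a b = \<tau> \<circ> flip (- b) (- a)"
    using assms False by (simp add: descents_uminus)
  then show ?thesis using assms(1) unfolding weak_covered_iff by blast
qed (use assms weak_covered_iff in blast)

section \<open>Weak order as containment of inversion sets\<close>

lemma inversions_descents_subset:
  assumes \<sigma>: "\<sigma> \<in> signed_perms n" and \<tau>: "\<tau> \<in> signed_perms n"
    and sub: "inversions n \<sigma> \<subseteq> inversions n \<tau>"
    and desc: "\<And>a b. (a, b) \<in> descents n \<tau> \<Longrightarrow> (\<tau> b, \<tau> a) \<in> inversions n \<sigma>"
  shows "\<sigma> = \<tau>"
proof -
  have "inversions n \<tau> \<subseteq> inversions n \<sigma>"
  proof (rule inversions_subsetI[OF \<tau>])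
    fix a b x z
    assume "(a, b) \<in> descents n \<tau>" "x \<in> labels n" "z \<in> labels n" "\<tau> b \<le> x" "x < z" "z \<le> \<tau> a"
      "inv \<tau> z \<le> a" "b \<le> inv \<tau> x"
    then show "inv \<sigma> z < inv \<sigma> x"
      using inversions_subset_of_descents[OF \<sigma> \<tau> sub, of a b x z] desc[of a b]
      by (simp add: inversions_def)
  qed
  then show ?thesis using inversions_inj[OF \<sigma> \<tau>] sub by blast
qed

lemma inversions_subset_swap:
  assumes \<sigma>: "\<sigma> \<in> signed_perms n" and \<tau>: "\<tau> \<in> signed_perms n"
    and sub: "inversions n \<sigma> \<subseteq> inversions n \<tau>"
    and ab: "(a, b) \<in> descents n \<tau>" "(\<tau> b, \<tau> a) \<notin> inversions n \<sigma>"
  shows "inversions n \<sigma> \<subseteq> inversions n (\<tau> \<circ> flip a b)"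
  using sub ab inversions_uminus[OF \<sigma>, of "\<tau> a" "\<tau> b"] by (auto simp: inversions_swap[OF \<tau> ab(1)])

text \<open>Conversely to the easy direction, walk down from \<open>\<tau>\<close>: unless
  \<open>\<sigma> = \<tau>\<close>, some descent of \<open>\<tau>\<close> is not inverted in
  \<open>\<sigma>\<close> by \<open>inversions_descents_subset\<close>, and undoing it loses only
  inversions that \<open>\<sigma>\<close> does not have. The number of inversions decreases at each
  step.\<close>

lemma weak_le_iff:
  assumes \<sigma>: "\<sigma> \<in> signed_perms n" and \<tau>: "\<tau> \<in> signed_perms n"
  shows "(weak_covered n)\<^sup>*\<^sup>* \<sigma> \<tau> \<longleftrightarrow> inversions n \<sigma> \<subseteq> inversions n \<tau>"
proof
  assume "(weak_covered n)\<^sup>*\<^sup>* \<sigma> \<tau>"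
  then show "inversions n \<sigma> \<subseteq> inversions n \<tau>"
    by (induction rule: rtranclp_induct) (auto simp: weak_covered_iff inversions_swap)
next
  assume "inversions n \<sigma> \<subseteq> inversions n \<tau>"
  then show "(weak_covered n)\<^sup>*\<^sup>* \<sigma> \<tau>"
    using \<tau>
  proof (induction "card (inversions n \<tau>)" arbitrary: \<tau> rule: less_induct)
    case less
    show ?case
    proof (cases "\<forall>a b. (a, b) \<in> descents n \<tau> \<longrightarrow> (\<tau> b, \<tau> a) \<in> inversions n \<sigma>")
      case True
      then show ?thesis
        using inversions_descents_subset[OF \<sigma> less.prems(2,1)] by blast
    next
      case False
      then obtain a b where ab: "(a, b) \<in> descents n \<tau>" "(\<tau> b, \<tau> a) \<notin> inversions n \<sigma>" by blast
      let ?x = "\<tau> \<circ> flip a b"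
      have "inversions n ?x \<subset> inversions n \<tau>"
        using descents_in_inversions[OF less.prems(2) ab(1)]
        by (auto simp: inversions_swap[OF less.prems(2) ab(1)])
      then have "card (inversions n ?x) < card (inversions n \<tau>)"
        by (rule psubset_card_mono[OF finite_inversions])
      then have "(weak_covered n)\<^sup>*\<^sup>* \<sigma> ?x"
        using less.hyps inversions_subset_swap[OF \<sigma> less.prems(2,1) ab]
          descents_swap_signed_perms[OF less.prems(2) ab(1)] by blast
      then show ?thesis
        by (rule rtranclp.rtrancl_into_rtrancl) (rule weak_covered_swap[OF less.prems(2) ab(1)])
    qed
  qed
qed

text \<open>The inversions lost by a lower cover reveal the descent that was undone, up to mirror
  image.\<close>

lemma swap_eq_imp:
  assumes \<tau>: "\<tau> \<in> signed_perms n" and ab: "(a, b) \<in> descents n \<tau>" and cd: "(c, d) \<in> descents n \<tau>"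
    and eq: "\<tau> \<circ> flip a b = \<tau> \<circ> flip c d"
  shows "(c, d) = (a, b) \<or> (c, d) = (- b, - a)"
proof -
  have "inversions n \<tau> - {(\<tau> b, \<tau> a), (- \<tau> a, - \<tau> b)} = inversions n \<tau> - {(\<tau> d, \<tau> c), (- \<tau> c, - \<tau> d)}"
    using inversions_swap[OF \<tau> ab] inversions_swap[OF \<tau> cd] eq by simp
  then have "(\<tau> d, \<tau> c) \<in> {(\<tau> b, \<tau> a), (\<tau> (- a), \<tau> (- b))}"
    using descents_in_inversions[OF \<tau> cd] by (auto simp: signed_perms_uminus[OF \<tau>])
  then show ?thesis by (auto simp: signed_perms_eq_iff[OF \<tau>])
qed

text \<open>Lower covers correspond to mirror pairs of descents, so a single lower cover means a
  single pair; for a central descent the two listed elements coincide.\<close>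

lemma join_irreducible_iff:
  "join_irreducible n j \<longleftrightarrow>
     j \<in> signed_perms n \<and> (\<exists>a b. descents n j = {(a, b), (- b, - a)})"
proof (intro iffI conjI)
  assume ji: "join_irreducible n j"
  then show j: "j \<in> signed_perms n" by (simp add: join_irreducible_def)
  from ji obtain x where x: "weak_covered n x j" "\<And>y. weak_covered n y j \<Longrightarrow> y = x"
    by (auto simp: join_irreducible_def)
  from x(1) obtain a b where ab: "(a, b) \<in> descents n j" "x = j \<circ> flip a b"
    by (auto simp: weak_covered_iff)
  have "(c, d) = (a, b) \<or> (c, d) = (- b, - a)" if "(c, d) \<in> descents n j" for c d
    using swap_eq_imp[OF j ab(1) that] x(2)[OF weak_covered_swap[OF j that]] ab(2) by simp
  then have "descents n j = {(a, b), (- b, - a)}"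
    using ab(1) descents_uminus[OF j] by auto
  then show "\<exists>a b. descents n j = {(a, b), (- b, - a)}" by blast
next
  assume "j \<in> signed_perms n \<and> (\<exists>a b. descents n j = {(a, b), (- b, - a)})"
  then obtain a b where j: "j \<in> signed_perms n" and ab: "descents n j = {(a, b), (- b, - a)}" by blast
  then have "a \<noteq> 0" "b \<noteq> 0" "a \<noteq> b" by (auto simp: descents_def labels_def set_eq_iff)
  then have "y = j \<circ> flip a b" if "weak_covered n y j" for y
    using that ab flip_mirror by (auto simp: weak_covered_iff)
  moreover have "weak_covered n (j \<circ> flip a b) j"
    using weak_covered_swap[OF j] ab by blast
  ultimately show "join_irreducible n j"
    using j unfolding join_irreducible_def by blast
qed

section \<open>Canonical joinands\<close>

text \<open>The passing rule for arcs in combinatorial form: these are the labeled points to the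
  left of the arc of the descent \<open>(a, b)\<close>.\<close>

definition left_values :: "nat \<Rightarrow> (int \<Rightarrow> int) \<Rightarrow> int \<Rightarrow> int \<Rightarrow> int set" where
  "left_values n \<sigma> a b = {v \<in> labels n. \<sigma> b < v \<and> v < \<sigma> a \<and> inv \<sigma> v < a}"

text \<open>A descent and its mirror image carry the same information, and exactly one of them satisfies
  \<open>0 \<le> \<sigma> a + \<sigma> b\<close>, unless they coincide.\<close>

definition arcs :: "nat \<Rightarrow> (int \<Rightarrow> int) \<Rightarrow> (int \<times> int \<times> int set) set" where
  "arcs n \<sigma> = {(\<sigma> a, \<sigma> b, left_values n \<sigma> a b) | a b. (a, b) \<in> descents n \<sigma> \<and> 0 \<le> \<sigma> a + \<sigma> b}"

lemma inv_eq_signed_perms: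
  assumes "\<sigma> \<in> signed_perms n"
  shows "inv \<sigma> v = c \<longleftrightarrow> v = \<sigma> c"
  using signed_perms_inverses(1)[OF assms, of c] signed_perms_inverses(2)[OF assms, of v] by auto

text \<open>Whether a value between the two ends stands before or after the descent is recorded in
  \<open>left_values\<close>, so two permutations sharing an arc agree on it. No label lies strictly
  between \<open>c\<close> and \<open>d\<close>, hence a value not at or before \<open>c\<close> is
  at or after \<open>d\<close>.\<close>

lemma left_values_separate:
  assumes \<sigma>: "\<sigma> \<in> signed_perms n" and \<tau>: "\<tau> \<in> signed_perms n"
    and ab: "(a, b) \<in> descents n \<sigma>" and cd: "(c, d) \<in> descents n \<tau>"
    and eq: "\<sigma> a = \<tau> c" "\<sigma> b = \<tau> d" "left_values n \<sigma> a b = left_values n \<tau> c d"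
    and xz: "x \<in> labels n" "z \<in> labels n" "\<sigma> b \<le> x" "x < z" "z \<le> \<sigma> a"
    and pos: "inv \<sigma> z \<le> a" "b \<le> inv \<sigma> x"
  shows "inv \<tau> z \<le> c" "d \<le> inv \<tau> x"
proof -
  show "inv \<tau> z \<le> c"
  proof (cases "z = \<sigma> a")
    case True
    then show ?thesis using inv_eq_signed_perms[OF \<tau>, of z c] eq(1) by simp
  next
    case False
    then have "inv \<sigma> z < a" using inv_eq_signed_perms[OF \<sigma>, of z a] pos(1) by simp
    then have "z \<in> left_values n \<sigma> a b" using xz False by (simp add: left_values_def)
    then show ?thesis unfolding eq(3) by (simp add: left_values_def)
  qed
  show "d \<le> inv \<tau> x"
  proof (cases "x = \<sigma> b")
    case True
    then show ?thesis using inv_eq_signed_perms[OF \<tau>, of x d] eq(2) by simp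
  next
    case False
    have "a < b" using ab by (simp add: descents_def)
    then have "x \<notin> left_values n \<sigma> a b" using pos(2) by (simp add: left_values_def)
    then have "\<not> inv \<tau> x < c"
      using xz False unfolding eq(3) by (simp add: left_values_def eq(1,2)[symmetric])
    moreover have "inv \<tau> x \<noteq> c" using inv_eq_signed_perms[OF \<tau>, of x c] xz eq(1) by simp
    moreover have "inv \<tau> x \<in> labels n"
      using signed_perms_in_labels[OF signed_perms_inv[OF \<tau>]] xz(1) by simp
    ultimately show ?thesis using descents_consecutive[OF cd] by fastforce
  qed
qed

text \<open>A crossing of a descent that is not normalized turns, under negation of values and
  positions, into a crossing of its normalized mirror image.\<close>

lemma inversions_subsetI_normalized:
  assumes \<tau>: "\<tau> \<in> signed_perms n" and \<upsilon>: "\<upsilon> \<in> signed_perms n"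
    and H: "\<And>a b x z. \<lbrakk>(a, b) \<in> descents n \<tau>; 0 \<le> \<tau> a + \<tau> b; x \<in> labels n; z \<in> labels n;
      \<tau> b \<le> x; x < z; z \<le> \<tau> a; inv \<tau> z \<le> a; b \<le> inv \<tau> x\<rbrakk> \<Longrightarrow> inv \<upsilon> z < inv \<upsilon> x"
  shows "inversions n \<tau> \<subseteq> inversions n \<upsilon>"
proof (rule inversions_subsetI[OF \<tau>])
  fix a b x z
  assume *: "(a, b) \<in> descents n \<tau>" "x \<in> labels n" "z \<in> labels n" "\<tau> b \<le> x" "x < z" "z \<le> \<tau> a"
    "inv \<tau> z \<le> a" "b \<le> inv \<tau> x"
  show "inv \<upsilon> z < inv \<upsilon> x"
  proof (cases "0 \<le> \<tau> a + \<tau> b")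
    case False
    then have "inv \<upsilon> (- x) < inv \<upsilon> (- z)"
      using * descents_uminus[OF \<tau>, of b a]
      by (intro H[of "- b" "- a"])
        (simp_all add: signed_perms_uminus[OF \<tau>] signed_perms_inv_uminus[OF \<tau>])
    then show ?thesis by (simp add: signed_perms_inv_uminus[OF \<upsilon>])
  qed (use * H in blast)
qed

lemma join_irreducible_descents:
  assumes "join_irreducible n j" "(a, b) \<in> descents n j"
  shows "descents n j = {(a, b), (- b, - a)}"
proof -
  obtain c d where cd: "descents n j = {(c, d), (- d, - c)}"
    using assms(1) unfolding join_irreducible_iff by blast
  then have "(a, b) = (c, d) \<or> (a, b) = (- d, - c)"
    using assms(2) by blast
  then show ?thesis
    by (elim disjE) (simp_all add: cd insert_commute)
qed

text \<open>If a descent and its mirror image are both normalized, their two values are opposite and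
  the descent is its own mirror image.\<close>

lemma arcs_join_irreducible:
  assumes j: "join_irreducible n j" and ab: "(a, b) \<in> descents n j" "0 \<le> j a + j b"
  shows "arcs n j = {(j a, j b, left_values n j a b)}"
proof -
  have sp: "j \<in> signed_perms n" using j by (simp add: join_irreducible_def)
  have "(c, d) = (a, b)" if "(c, d) \<in> descents n j" "0 \<le> j c + j d" for c d
  proof (rule ccontr)
    assume "(c, d) \<noteq> (a, b)"
    then have cd: "c = - b" "d = - a" using join_irreducible_descents[OF j ab(1)] that(1) by auto
    then have "j a = j (- b)" using ab(2) that(2) by (simp add: signed_perms_uminus[OF sp])
    then have "a = - b" by (simp add: signed_perms_eq_iff[OF sp])
    then show False using cd \<open>(c, d) \<noteq> (a, b)\<close> by simp
  qed
  then show ?thesis using ab unfolding arcs_def by blast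
qed

lemma arcs_join_irreducible_obtain:
  assumes j: "join_irreducible n j"
  obtains a b where "(a, b) \<in> descents n j" "0 \<le> j a + j b"
    "arcs n j = {(j a, j b, left_values n j a b)}"
proof -
  have sp: "j \<in> signed_perms n" using j by (simp add: join_irreducible_def)
  obtain a b where ab: "(a, b) \<in> descents n j" using j by (auto simp: join_irreducible_iff)
  obtain c d where "(c, d) \<in> descents n j" "0 \<le> j c + j d"
  proof (cases "0 \<le> j a + j b")
    case False
    then show ?thesis
      using that[of "- b" "- a"] ab descents_uminus[OF sp, of b a]
      by (simp add: signed_perms_uminus[OF sp])
  qed (use ab that in blast)
  then show ?thesis using arcs_join_irreducible[OF j] that by blast
qed

text \<open>The inversions of \<open>j\<close> are generated by those crossing its normalized
  descent. Sharing the arc with \<open>\<pi>\<close> turns each of these into a crossing of the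
  corresponding descent of \<open>\<pi>\<close>, which \<open>\<sigma>\<close> inverts once it
  inverts the two end values. Used with \<open>\<sigma>\<close> a lower cover of
  \<open>\<pi>\<close>, a joinand, or \<open>\<pi>\<close> itself.\<close>

lemma inversions_join_irreducible_subset:
  assumes j: "join_irreducible n j" and \<pi>: "\<pi> \<in> signed_perms n" and \<sigma>: "\<sigma> \<in> signed_perms n"
    and arcs: "arcs n j = {(p, q, R)}" "(p, q, R) \<in> arcs n \<pi>"
    and sub: "inversions n \<sigma> \<subseteq> inversions n \<pi>" and pq: "(q, p) \<in> inversions n \<sigma>"
  shows "inversions n j \<subseteq> inversions n \<sigma>"
proof (rule inversions_subsetI_normalized[OF _ \<sigma>])
  show sp: "j \<in> signed_perms n" using j by (simp add: join_irreducible_def)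
  fix a b x z
  assume ab: "(a, b) \<in> descents n j" "0 \<le> j a + j b"
    and xz: "x \<in> labels n" "z \<in> labels n" "j b \<le> x" "x < z" "z \<le> j a" "inv j z \<le> a" "b \<le> inv j x"
  have eq: "p = j a" "q = j b" "R = left_values n j a b"
    using arcs_join_irreducible[OF j ab] arcs(1) by auto
  obtain c d where cd: "(c, d) \<in> descents n \<pi>" "j a = \<pi> c" "j b = \<pi> d"
    "left_values n j a b = left_values n \<pi> c d"
    using arcs(2) unfolding eq arcs_def by auto
  have "inv \<sigma> (\<pi> c) < inv \<sigma> (\<pi> d)" using pq eq cd by (simp add: inversions_def)
  then show "inv \<sigma> z < inv \<sigma> x"
    using inversions_subset_of_descents[OF \<sigma> \<pi> sub cd(1) _ xz(1,2)]
      left_values_separate[OF sp \<pi> ab(1) cd xz] xz cd by simp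
qed

text \<open>A minimal element below \<open>\<pi>\<close> that still inverts the two values of a descent can only have
  that descent and its mirror image.\<close>

lemma join_irreducible_of_descent:
  assumes \<pi>: "\<pi> \<in> signed_perms n" and cd: "(c, d) \<in> descents n \<pi>"
  obtains j a b where "join_irreducible n j" "(a, b) \<in> descents n j" "j a = \<pi> c" "j b = \<pi> d"
    "left_values n j a b = left_values n \<pi> c d"
proof -
  define P where "P j \<longleftrightarrow> j \<in> signed_perms n \<and> inversions n j \<subseteq> inversions n \<pi> \<and>
    (\<pi> d, \<pi> c) \<in> inversions n j" for j
  have "P \<pi>" using \<pi> descents_in_inversions[OF \<pi> cd] by (simp add: P_def)
  then obtain j where "P j" and min: "\<And>k. P k \<Longrightarrow> card (inversions n j) \<le> card (inversions n k)"
    using ex_has_least_nat[of P \<pi> "\<lambda>j. card (inversions n j)"] by blast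
  then have j: "j \<in> signed_perms n" and sub: "inversions n j \<subseteq> inversions n \<pi>"
    and dc: "(\<pi> d, \<pi> c) \<in> inversions n j" by (auto simp: P_def)
  \<comment> \<open>Undoing any other descent would keep the prescribed inversion and leave fewer
    inversions.\<close>
  have desc: "(\<pi> d, \<pi> c) = (j b, j a) \<or> (\<pi> d, \<pi> c) = (- j a, - j b)" if ab: "(a, b) \<in> descents n j" for a b
  proof (rule ccontr)
    assume neg: "\<not> ?thesis"
    let ?k = "j \<circ> flip a b"
    have inv_k: "inversions n ?k = inversions n j - {(j b, j a), (- j a, - j b)}"
      by (rule inversions_swap[OF j ab])
    have "P ?k"
      using neg sub dc descents_swap_signed_perms[OF j ab] unfolding P_def inv_k by blast
    moreover have "inversions n ?k \<subset> inversions n j"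
      using descents_in_inversions[OF j ab] unfolding inv_k by blast
    then have "card (inversions n ?k) < card (inversions n j)"
      by (rule psubset_card_mono[OF finite_inversions])
    ultimately show False using min[of ?k] by simp
  qed
  have "descents n j \<noteq> {}"
  proof
    assume "descents n j = {}"
    then have "inversions n j \<subseteq> inversions n id"
      by (intro inversions_subsetI[OF j]) auto
    then show False using dc by (auto simp: inversions_def)
  qed
  then obtain a b where ab0: "(a, b) \<in> descents n j" by auto
  obtain a b where ab: "(a, b) \<in> descents n j" "j a = \<pi> c" "j b = \<pi> d"
  proof (cases "(\<pi> d, \<pi> c) = (j b, j a)")
    case False
    then have "\<pi> d = - j a" "\<pi> c = - j b" using desc[OF ab0] by auto
    then show ?thesis
      using that[of "- b" "- a"] ab0 descents_uminus[OF j] by (simp add: signed_perms_uminus[OF j])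
  qed (use that ab0 in auto)
  have "(e, f) = (a, b) \<or> (e, f) = (- b, - a)" if "(e, f) \<in> descents n j" for e f
  proof -
    have "(j b, j a) = (j f, j e) \<or> (j b, j a) = (j (- e), j (- f))"
      using desc[OF that] ab(2,3) by (simp add: signed_perms_uminus[OF j])
    then show ?thesis by (auto simp: signed_perms_eq_iff[OF j])
  qed
  then have "descents n j = {(a, b), (- b, - a)}"
    using ab(1) descents_uminus[OF j] by auto
  then have ji: "join_irreducible n j" using j by (auto simp: join_irreducible_iff)
  have lab: "\<pi> c \<in> labels n" "\<pi> d \<in> labels n" and "a < b" "c < d"
    using dc cd ab by (auto simp: inversions_def descents_def)
  \<comment> \<open>Passing from \<open>\<pi>\<close> down to \<open>j\<close> creates no inversion:
    a value before the descent stays before the upper value, and one after it stays after the lower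
    value.\<close>
  have "inv j v < a \<longleftrightarrow> inv \<pi> v < c" if v: "v \<in> labels n" "\<pi> d < v" "v < \<pi> c" for v
  proof
    assume "inv \<pi> v < c"
    then show "inv j v < a"
      using inv_less_of_inversions_subset[OF j sub v(1) lab(1) v(3)]
        inv_eq_signed_perms[OF \<pi>, of "\<pi> c" c] inv_eq_signed_perms[OF j, of "\<pi> c" a] ab by simp
  next
    assume "inv j v < a"
    show "inv \<pi> v < c"
    proof (rule ccontr)
      assume "\<not> inv \<pi> v < c"
      then have "d < inv \<pi> v"
        using v descents_consecutive[OF cd, of "inv \<pi> v"] signed_perms_in_labels[OF signed_perms_inv[OF \<pi>], of v]
          inv_eq_signed_perms[OF \<pi>, of v c] inv_eq_signed_perms[OF \<pi>, of v d] by force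
      then have "b < inv j v"
        using inv_less_of_inversions_subset[OF j sub lab(2) v(1) v(2)]
          inv_eq_signed_perms[OF \<pi>, of "\<pi> d" d] inv_eq_signed_perms[OF j, of "\<pi> d" b] ab by simp
      then show False using \<open>inv j v < a\<close> \<open>a < b\<close> by simp
    qed
  qed
  then have "left_values n j a b = left_values n \<pi> c d"
    using ab by (auto simp: left_values_def)
  then show ?thesis using that ji ab by blast
qed

text \<open>Two canonical representations generate the same order ideal, and an antichain is the set
  of maximal elements of the ideal it generates.\<close>

lemma canonical_join_rep_unique:
  assumes refl: "\<And>x. x \<in> carrier L \<Longrightarrow> x \<sqsubseteq>\<^bsub>L\<^esub> x"
    and trans: "\<And>x y z. \<lbrakk>x \<in> carrier L; y \<in> carrier L; z \<in> carrier L; x \<sqsubseteq>\<^bsub>L\<^esub> y; y \<sqsubseteq>\<^bsub>L\<^esub> z\<rbrakk> \<Longrightarrow> x \<sqsubseteq>\<^bsub>L\<^esub> z"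
    and antisym: "\<And>x y. \<lbrakk>x \<in> carrier L; y \<in> carrier L; x \<sqsubseteq>\<^bsub>L\<^esub> y; y \<sqsubseteq>\<^bsub>L\<^esub> x\<rbrakk> \<Longrightarrow> x = y"
    and X: "canonical_join_rep L u X" and Y: "canonical_join_rep L u Y"
  shows "X = Y"
proof -
  have sub: "X \<subseteq> Y" if X: "canonical_join_rep L u X" and Y: "canonical_join_rep L u Y" for X Y
  proof
    fix x assume x: "x \<in> X"
    have carr: "X \<subseteq> carrier L" "Y \<subseteq> carrier L"
      and anti: "\<And>y z. y \<in> X \<Longrightarrow> z \<in> X \<Longrightarrow> y \<sqsubseteq>\<^bsub>L\<^esub> z \<Longrightarrow> y = z"
      using X Y by (auto simp: canonical_join_rep_def antichain_in_def)
    have ideal: "order_ideal L X \<subseteq> order_ideal L Y" "order_ideal L Y \<subseteq> order_ideal L X"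
      using X Y carr unfolding canonical_join_rep_def by blast+
    have "x \<in> order_ideal L X" using x carr refl by (auto simp: order_ideal_def)
    then obtain y where y: "y \<in> Y" "x \<sqsubseteq>\<^bsub>L\<^esub> y" using ideal(1) by (auto simp: order_ideal_def)
    have "y \<in> order_ideal L Y" using y carr refl by (auto simp: order_ideal_def)
    then obtain z where z: "z \<in> X" "y \<sqsubseteq>\<^bsub>L\<^esub> z" using ideal(2) by (auto simp: order_ideal_def)
    have "x \<sqsubseteq>\<^bsub>L\<^esub> z" using trans[of x y z] x y z carr by blast
    then have "z = x" using anti x z by blast
    then have "x = y" using antisym[of x y] x y z carr by blast
    then show "x \<in> Y" using y by simp
  qed
  show ?thesis using sub[OF X Y] sub[OF Y X] by blast
qed

lemma canonical_join_rep_weak_order: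
  assumes \<pi>: "\<pi> \<in> signed_perms n"
  shows "canonical_join_rep (weak_order n) \<pi> {j. join_irreducible n j \<and> arcs n j \<subseteq> arcs n \<pi>}"
proof -
  let ?L = "weak_order n"
  let ?X = "{j. join_irreducible n j \<and> arcs n j \<subseteq> arcs n \<pi>}"
  have carrier: "carrier ?L = signed_perms n" by (simp add: weak_order_def)
  have le: "x \<sqsubseteq>\<^bsub>?L\<^esub> y \<longleftrightarrow> inversions n x \<subseteq> inversions n y"
    if "x \<in> signed_perms n" "y \<in> signed_perms n" for x y
    using weak_le_iff[OF that] by (simp add: weak_order_def)
  have sp: "j \<in> signed_perms n" if "join_irreducible n j" for j
    using that by (simp add: join_irreducible_def)
  have X: "?X \<subseteq> signed_perms n" using sp by blast
  have X_obtain: "\<exists>a b c d. (a, b) \<in> descents n j \<and> (c, d) \<in> descents n \<pi> \<and> j a = \<pi> c \<and> j b = \<pi> d \<and>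
      arcs n j = {(\<pi> c, \<pi> d, left_values n \<pi> c d)} \<and> (\<pi> c, \<pi> d, left_values n \<pi> c d) \<in> arcs n \<pi>"
    if "j \<in> ?X" for j
  proof -
    obtain a b where ab: "(a, b) \<in> descents n j" "0 \<le> j a + j b"
      and arc: "arcs n j = {(j a, j b, left_values n j a b)}"
      using arcs_join_irreducible_obtain \<open>j \<in> ?X\<close> by blast
    then have "(j a, j b, left_values n j a b) \<in> arcs n \<pi>" using that by auto
    then obtain c d where "(c, d) \<in> descents n \<pi>" "j a = \<pi> c" "j b = \<pi> d"
      "left_values n j a b = left_values n \<pi> c d" unfolding arcs_def by auto
    then show ?thesis using ab arc that by auto
  qed
  have below: "inversions n j \<subseteq> inversions n \<sigma>"
    if "j \<in> ?X" "arcs n j = {(\<pi> c, \<pi> d, R)}" "\<sigma> \<in> signed_perms n"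
      "inversions n \<sigma> \<subseteq> inversions n \<pi>" "(\<pi> d, \<pi> c) \<in> inversions n \<sigma>" for j c d R \<sigma>
    using inversions_join_irreducible_subset[of n j \<pi> \<sigma>, OF _ \<pi>] that by blast
  have X_le: "inversions n j \<subseteq> inversions n \<pi>" if j: "j \<in> ?X" for j
    using X_obtain[OF j] below[OF j _ \<pi>] descents_in_inversions[OF \<pi>] by blast
  have "antichain_in ?L ?X"
    unfolding antichain_in_def carrier
  proof (intro conjI X ballI impI)
    fix j k assume j: "j \<in> ?X" and k: "k \<in> ?X" and "j \<sqsubseteq>\<^bsub>?L\<^esub> k"
    then have jk: "inversions n j \<subseteq> inversions n k" using le X by blast
    obtain a b c d where ab: "(a, b) \<in> descents n j" "j a = \<pi> c" "j b = \<pi> d"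
      and cd: "(c, d) \<in> descents n \<pi>" and arc_j: "arcs n j = {(\<pi> c, \<pi> d, left_values n \<pi> c d)}"
      and "(\<pi> c, \<pi> d, left_values n \<pi> c d) \<in> arcs n \<pi>"
      using X_obtain[OF j] by blast
    obtain a' b' c' d' where ab': "(a', b') \<in> descents n k" "k a' = \<pi> c'" "k b' = \<pi> d'"
      and cd': "(c', d') \<in> descents n \<pi>" and arc_k: "arcs n k = {(\<pi> c', \<pi> d', left_values n \<pi> c' d')}"
      using X_obtain[OF k] by blast
    have dc: "(\<pi> d, \<pi> c) \<in> inversions n j"
      using descents_in_inversions[OF _ ab(1)] j sp ab by auto
    have d'c': "(\<pi> d', \<pi> c') \<in> inversions n k"
      using descents_in_inversions[OF _ ab'(1)] k sp ab' by auto
    \<comment> \<open>If the lower cover of \<open>\<pi>\<close> at the descent for \<open>j\<close>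
      still inverted the values of the descent for \<open>k\<close>, then \<open>k\<close>, and with
      it \<open>j\<close>, would lie below that cover, which does not invert the values for
      \<open>j\<close>. So the two descents agree up to mirror image, and \<open>k\<close> lies
      below \<open>j\<close>.\<close>
    have "inversions n k \<subseteq> inversions n j"
    proof (cases "(\<pi> d', \<pi> c') \<in> inversions n (\<pi> \<circ> flip c d)")
      case True
      then have "inversions n k \<subseteq> inversions n (\<pi> \<circ> flip c d)"
        using below[OF k arc_k descents_swap_signed_perms[OF \<pi> cd]] inversions_swap[OF \<pi> cd] by blast
      then show ?thesis using dc jk inversions_swap[OF \<pi> cd] by blast
    next
      case False
      then have "(\<pi> d', \<pi> c') = (\<pi> d, \<pi> c) \<or> (\<pi> d', \<pi> c') = (- \<pi> c, - \<pi> d)"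
        using descents_in_inversions[OF \<pi> cd'] inversions_swap[OF \<pi> cd] by blast
      then have "(\<pi> d', \<pi> c') \<in> inversions n j"
        using dc inversions_uminus[of j n "\<pi> c" "\<pi> d"] j sp by auto
      then show ?thesis using below[OF k arc_k _ X_le[OF j]] j sp by blast
    qed
    then show "j = k" using inversions_inj[of j n k] j k jk sp by blast
  qed
  moreover have "is_lub ?L \<pi> ?X"
    unfolding least_def Upper_def carrier
  proof (intro conjI ballI)
    show "\<pi> \<in> {u. \<forall>x. x \<in> ?X \<inter> signed_perms n \<longrightarrow> x \<sqsubseteq>\<^bsub>?L\<^esub> u} \<inter> signed_perms n"
      using X_le \<pi> le sp by blast
    fix u assume u: "u \<in> {u. \<forall>x. x \<in> ?X \<inter> signed_perms n \<longrightarrow> x \<sqsubseteq>\<^bsub>?L\<^esub> u} \<inter> signed_perms n"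
    \<comment> \<open>Every inversion of \<open>\<pi>\<close> crossing a normalized descent is
      already an inversion of the join-irreducible with that arc, hence of the upper bound
      \<open>u\<close>.\<close>
    have "inversions n \<pi> \<subseteq> inversions n u"
    proof (rule inversions_subsetI_normalized[OF \<pi>])
      show "u \<in> signed_perms n" using u by blast
      fix c d x z
      assume cd: "(c, d) \<in> descents n \<pi>" "0 \<le> \<pi> c + \<pi> d"
        and xz: "x \<in> labels n" "z \<in> labels n" "\<pi> d \<le> x" "x < z" "z \<le> \<pi> c" "inv \<pi> z \<le> c" "d \<le> inv \<pi> x"
      obtain j a b where j: "join_irreducible n j" and ab: "(a, b) \<in> descents n j" "j a = \<pi> c" "j b = \<pi> d"
        "left_values n j a b = left_values n \<pi> c d"
        using join_irreducible_of_descent[OF \<pi> cd(1)] by blast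
      then have "arcs n j = {(\<pi> c, \<pi> d, left_values n \<pi> c d)}"
        using arcs_join_irreducible[OF j ab(1)] cd(2) by simp
      then have "j \<in> ?X" using j cd by (auto simp: arcs_def)
      then have sub: "inversions n j \<subseteq> inversions n u" using u le sp by blast
      have "inv j z \<le> a" "b \<le> inv j x"
        using left_values_separate[OF \<pi> sp[OF j] cd(1) ab(1) _ _ _ xz] ab by simp_all
      moreover have "a < b" using ab(1) by (simp add: descents_def)
      ultimately have "(x, z) \<in> inversions n j" using xz by (simp add: inversions_def)
      then show "inv u z < inv u x" using sub by (auto simp: inversions_def)
    qed
    then show "\<pi> \<sqsubseteq>\<^bsub>?L\<^esub> u" using le u \<pi> by blast
  qed (use X in auto)
  moreover have "order_ideal ?L ?X \<subseteq> order_ideal ?L Y"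
    if Y: "Y \<subseteq> carrier ?L" and lub: "is_lub ?L \<pi> Y" for Y
  proof
    fix y assume "y \<in> order_ideal ?L ?X"
    then obtain j where y: "y \<in> signed_perms n" and j: "j \<in> ?X" and "y \<sqsubseteq>\<^bsub>?L\<^esub> j"
      unfolding order_ideal_def carrier by blast
    then have yj: "inversions n y \<subseteq> inversions n j" using le X by blast
    obtain c d where cd: "(c, d) \<in> descents n \<pi>" and arc_j: "arcs n j = {(\<pi> c, \<pi> d, left_values n \<pi> c d)}"
      using X_obtain[OF j] by blast
    have Y_sp: "x \<in> signed_perms n" if "x \<in> Y" for x using Y that carrier by blast
    have Y_le: "inversions n x \<subseteq> inversions n \<pi>" if "x \<in> Y" for x
      using lub that Y_sp[OF that] \<pi> le unfolding least_def Upper_def carrier by blast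
    \<comment> \<open>Otherwise the lower cover of \<open>\<pi>\<close> at this descent would be an
      upper bound of \<open>Y\<close> strictly below its join.\<close>
    have "\<exists>x\<in>Y. (\<pi> d, \<pi> c) \<in> inversions n x"
    proof (rule ccontr)
      assume neg: "\<not> ?thesis"
      let ?u = "\<pi> \<circ> flip c d"
      have u: "?u \<in> signed_perms n" by (rule descents_swap_signed_perms[OF \<pi> cd])
      have "x \<sqsubseteq>\<^bsub>?L\<^esub> ?u" if "x \<in> Y" for x
        using inversions_subset_swap[OF Y_sp[OF that] \<pi> Y_le[OF that] cd] neg that
          le[OF Y_sp[OF that] u] by blast
      then have "\<pi> \<sqsubseteq>\<^bsub>?L\<^esub> ?u"
        using lub u unfolding least_def Upper_def carrier by blast
      then have "inversions n \<pi> \<subseteq> inversions n ?u" using le[OF \<pi> u] by blast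
      then show False
        using descents_in_inversions[OF \<pi> cd] inversions_swap[OF \<pi> cd] by blast
    qed
    then obtain x where x: "x \<in> Y" "(\<pi> d, \<pi> c) \<in> inversions n x" by blast
    then have "inversions n j \<subseteq> inversions n x" using below[OF j arc_j] Y_sp Y_le by blast
    then have "y \<sqsubseteq>\<^bsub>?L\<^esub> x" using le[OF y Y_sp[OF x(1)]] yj by blast
    then show "y \<in> order_ideal ?L Y" using x y unfolding order_ideal_def carrier by blast
  qed
  ultimately show ?thesis by (simp add: canonical_join_rep_def)
qed

lemma canonical_join_rep_weak_order_iff:
  assumes \<pi>: "\<pi> \<in> signed_perms n"
  shows "canonical_join_rep (weak_order n) \<pi> X \<longleftrightarrow>
    X = {j. join_irreducible n j \<and> arcs n j \<subseteq> arcs n \<pi>}"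
proof
  have carrier: "carrier (weak_order n) = signed_perms n" by (simp add: weak_order_def)
  have le: "x \<sqsubseteq>\<^bsub>weak_order n\<^esub> y \<longleftrightarrow> (weak_covered n)\<^sup>*\<^sup>* x y" for x y
    by (simp add: weak_order_def)
  assume "canonical_join_rep (weak_order n) \<pi> X"
  then show "X = {j. join_irreducible n j \<and> arcs n j \<subseteq> arcs n \<pi>}"
  proof (rule canonical_join_rep_unique[rotated 3])
    show "canonical_join_rep (weak_order n) \<pi> {j. join_irreducible n j \<and> arcs n j \<subseteq> arcs n \<pi>}"
      by (rule canonical_join_rep_weak_order[OF \<pi>])
    fix x y
    assume "x \<in> carrier (weak_order n)" "y \<in> carrier (weak_order n)"
      "x \<sqsubseteq>\<^bsub>weak_order n\<^esub> y" "y \<sqsubseteq>\<^bsub>weak_order n\<^esub> x"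
    then show "x = y"
      unfolding carrier le using weak_le_iff[of x n y] weak_le_iff[of y n x] inversions_inj[of x n y] by blast
  qed (auto simp: le intro: rtranclp_trans)
qed (use canonical_join_rep_weak_order[OF \<pi>] in blast)

section \<open>Combinatorial data of type-B arcs\<close>

text \<open>At negative heights the unfolded arc is the half-turn image of the second piece, with
  coordinate \<open>- g (- t)\<close> at height \<open>t\<close>; this is positive where
  \<open>g (- t)\<close> is negative.\<close>

definition sides :: "nat \<Rightarrow> int \<Rightarrow> int \<Rightarrow> (real \<Rightarrow> real) \<Rightarrow> (real \<Rightarrow> real) \<Rightarrow> int set" where
  "sides n p q f g = {i \<in> labels n. q < i \<and> i < p \<and>
     (if 0 < i then 0 < f (of_int i) else g (of_int (- i)) < 0)}"

text \<open>Orbifold arcs are encoded with \<open>q = - p\<close> and long arcs with \<open>- q\<close> the lower endpoint, as if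
  unfolded into the symmetric model; \<open>R\<close> collects the labeled points that lie to the left of the
  unfolded arc.\<close>

definition arc_data :: "nat \<Rightarrow> orbifold_point set \<Rightarrow> int \<Rightarrow> int \<Rightarrow> int set \<Rightarrow> bool" where
  "arc_data n B p q R \<longleftrightarrow>
     (\<exists>f. ordinary_arc n p q f B \<and> R = sides n p q f f) \<or>
     (\<exists>f. orbifold_arc n p f B \<and> q = - p \<and> R = sides n p (- p) f f) \<or>
     (\<exists>f g. long_arc n p (- q) f g B \<and> R = sides n p q f g)"

lemma sgn_eq_iff_pos: "\<lbrakk>(x::real) \<noteq> 0; y \<noteq> 0\<rbrakk> \<Longrightarrow> sgn x = sgn y \<longleftrightarrow> (0 < x \<longleftrightarrow> 0 < y)"
  by (auto simp: sgn_if)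

lemma same_sides_iff:
  assumes "descends n p h f" "descends n p h f'"
  shows "same_sides n p h f f' \<longleftrightarrow>
    (\<forall>i\<in>labels n. h < i \<and> i < p \<longrightarrow> (0 < f (of_int i) \<longleftrightarrow> 0 < f' (of_int i)))"
  using assms unfolding same_sides_def descends_def by (meson sgn_eq_iff_pos)

lemma sides_eq_iff_ordinary:
  assumes "descends n p q f" "descends n p q f'" "0 < q"
  shows "sides n p q f f = sides n p q f' f' \<longleftrightarrow> same_sides n p q f f'"
proof -
  have "sides n p q h h = {i \<in> labels n. q < i \<and> i < p \<and> 0 < h (of_int i)}" for h
    using assms(3) by (auto simp: sides_def)
  then show ?thesis unfolding same_sides_iff[OF assms(1,2)] by blast
qed

text \<open>Since \<open>descends\<close> forbids zeros at intermediate labels, a sign is a choice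
  between two, and one set can store both pieces: the first at positive labels, the second at
  negative ones. Orbifold arcs are covered by taking both pieces equal.\<close>

lemma sides_eq_iff:
  assumes f: "descends n p 0 f" "descends n p 0 f'" and g: "descends n q 0 g" "descends n q 0 g'"
    and "0 < q" "0 < p"
  shows "sides n p (- q) f g = sides n p (- q) f' g' \<longleftrightarrow> same_sides n p 0 f f' \<and> same_sides n q 0 g g'"
proof -
  have neg: "x < 0 \<longleftrightarrow> \<not> 0 < x" if "x \<noteq> 0" for x :: real using that by auto
  have "sides n p (- q) f g = sides n p (- q) f' g' \<longleftrightarrow>
    (\<forall>i\<in>labels n. 0 < i \<and> i < p \<longrightarrow> (0 < f (of_int i) \<longleftrightarrow> 0 < f' (of_int i))) \<and>
    (\<forall>i\<in>labels n. - q < i \<and> i < 0 \<longrightarrow> (g (of_int (- i)) < 0 \<longleftrightarrow> g' (of_int (- i)) < 0))"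
  proof -
    have "sides n p (- q) f g = sides n p (- q) f' g' \<longleftrightarrow>
      (\<forall>i\<in>labels n. - q < i \<and> i < p \<longrightarrow>
        ((if 0 < i then 0 < f (of_int i) else g (of_int (- i)) < 0) \<longleftrightarrow>
         (if 0 < i then 0 < f' (of_int i) else g' (of_int (- i)) < 0)))"
      unfolding sides_def by blast
    moreover have "i < 0 \<longleftrightarrow> \<not> 0 < i" if "i \<in> labels n" for i
      using that by (auto simp: labels_def)
    moreover have "- q < i" if "0 < i" for i using that assms(5) by simp
    moreover have "i < p" if "\<not> 0 < i" for i using that assms(6) by simp
    ultimately show ?thesis by (smt (verit))
  qed
  also have "(\<forall>i\<in>labels n. - q < i \<and> i < 0 \<longrightarrow> (g (of_int (- i)) < 0 \<longleftrightarrow> g' (of_int (- i)) < 0)) \<longleftrightarrow>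
    (\<forall>i\<in>labels n. 0 < i \<and> i < q \<longrightarrow> (g (of_int i) < 0 \<longleftrightarrow> g' (of_int i) < 0))"
    (is "?L \<longleftrightarrow> ?R")
  proof
    assume L: ?L
    show ?R
    proof (intro ballI impI)
      fix i assume "i \<in> labels n" "0 < i \<and> i < q"
      then show "g (of_int i) < 0 \<longleftrightarrow> g' (of_int i) < 0" using L[rule_format, of "- i"] by simp
    qed
  next
    assume R: ?R
    show ?L
    proof (intro ballI impI)
      fix i assume "i \<in> labels n" "- q < i \<and> i < 0"
      then show "g (of_int (- i)) < 0 \<longleftrightarrow> g' (of_int (- i)) < 0" using R[rule_format, of "- i"] by simp
    qed
  qed
  also have "\<dots> \<longleftrightarrow> (\<forall>i\<in>labels n. 0 < i \<and> i < q \<longrightarrow> (0 < g (of_int i) \<longleftrightarrow> 0 < g' (of_int i)))"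
    using g neg unfolding descends_def by blast
  finally show ?thesis unfolding same_sides_iff[OF f] same_sides_iff[OF g] .
qed

text \<open>The encoding keeps the kinds apart: \<open>q\<close> is positive for ordinary arcs,
  equal to \<open>- p\<close> for orbifold arcs, and negative but different from \<open>- p\<close>
  for long arcs.\<close>

lemma ordinary_arc_data_iff:
  "0 < q \<Longrightarrow> arc_data n B p q R \<longleftrightarrow> (\<exists>f. ordinary_arc n p q f B \<and> R = sides n p q f f)"
  by (auto simp: arc_data_def orbifold_arc_def long_arc_def)

lemma orbifold_arc_data_iff:
  "arc_data n B p (- p) R \<longleftrightarrow> (\<exists>f. orbifold_arc n p f B \<and> R = sides n p (- p) f f)"
  by (auto simp: arc_data_def ordinary_arc_def long_arc_def)

lemma long_arc_data_iff:
  "\<lbrakk>q < 0; q \<noteq> - p\<rbrakk> \<Longrightarrow> arc_data n B p q R \<longleftrightarrow> (\<exists>f g. long_arc n p (- q) f g B \<and> R = sides n p q f g)"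
  by (auto simp: arc_data_def ordinary_arc_def orbifold_arc_def)

lemma type_B_arc_equiv_iff:
  "(B, B') \<in> type_B_arc_equiv n \<longleftrightarrow> (\<exists>p q R. arc_data n B p q R \<and> arc_data n B' p q R)"
proof
  assume "(B, B') \<in> type_B_arc_equiv n"
  then consider
      p q f f' where "ordinary_arc n p q f B" "ordinary_arc n p q f' B'" "same_sides n p q f f'"
    | p f f' where "orbifold_arc n p f B" "orbifold_arc n p f' B'" "same_sides n p 0 f f'"
    | p q f f' g g' where "long_arc n p q f g B" "long_arc n p q f' g' B'"
        "same_sides n p 0 f f'" "same_sides n q 0 g g'"
    unfolding type_B_arc_equiv_def by blast
  then show "\<exists>p q R. arc_data n B p q R \<and> arc_data n B' p q R"
  proof cases
    case 1
    then have "sides n p q f f = sides n p q f' f'"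
      by (subst sides_eq_iff_ordinary) (auto simp: ordinary_arc_def)
    then show ?thesis using 1 unfolding arc_data_def by metis
  next
    case 2
    then have "sides n p (- p) f f = sides n p (- p) f' f'"
      by (subst sides_eq_iff) (auto simp: orbifold_arc_def)
    then show ?thesis using 2 orbifold_arc_data_iff by metis
  next
    case 3
    then have "sides n p (- q) f g = sides n p (- q) f' g'"
      by (subst sides_eq_iff) (auto simp: long_arc_def)
    then have "arc_data n B p (- q) (sides n p (- q) f g) \<and> arc_data n B' p (- q) (sides n p (- q) f g)"
      using 3 unfolding arc_data_def by (metis minus_minus)
    then show ?thesis by blast
  qed
next
  assume "\<exists>p q R. arc_data n B p q R \<and> arc_data n B' p q R"
  then obtain p q R where data: "arc_data n B p q R" "arc_data n B' p q R" by blast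
  have "q \<noteq> 0" using data(1) by (auto simp: arc_data_def ordinary_arc_def orbifold_arc_def long_arc_def)
  then consider "0 < q" | "q = - p" | "q < 0" "q \<noteq> - p" by linarith
  then show "(B, B') \<in> type_B_arc_equiv n"
  proof cases
    case 1
    obtain f f' where arcs: "ordinary_arc n p q f B" "ordinary_arc n p q f' B'"
      and eq: "sides n p q f f = sides n p q f' f'"
      using data unfolding ordinary_arc_data_iff[OF 1] by auto
    have "same_sides n p q f f'"
      using eq arcs 1 by (subst (asm) sides_eq_iff_ordinary) (auto simp: ordinary_arc_def)
    then show ?thesis using arcs unfolding type_B_arc_equiv_def by blast
  next
    case 2
    obtain f f' where arcs: "orbifold_arc n p f B" "orbifold_arc n p f' B'"
      and eq: "sides n p (- p) f f = sides n p (- p) f' f'"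
      using data unfolding 2 orbifold_arc_data_iff by auto
    have "same_sides n p 0 f f'"
      using eq arcs by (subst (asm) sides_eq_iff) (auto simp: orbifold_arc_def)
    then show ?thesis using arcs unfolding type_B_arc_equiv_def by blast
  next
    case 3
    obtain f g f' g' where arcs: "long_arc n p (- q) f g B" "long_arc n p (- q) f' g' B'"
      and eq: "sides n p q f g = sides n p q f' g'"
      using data unfolding long_arc_data_iff[OF 3] by auto
    have "same_sides n p 0 f f' \<and> same_sides n (- q) 0 g g'"
      using eq arcs sides_eq_iff[of n p f f' "- q" g g'] by (auto simp: long_arc_def)
    then show ?thesis using arcs unfolding type_B_arc_equiv_def by blast
  qed
qed

section \<open>Recovering an arc from its point set\<close>

lemma Upper_pt_in_curve:
  assumes "0 \<le> h"
  shows "Upper_pt (Complex x t) \<in> orbifold_proj ` curve_over f h p \<longleftrightarrow>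
    0 < t \<and> of_int h \<le> t \<and> t \<le> of_int p \<and> x = f t"
proof
  assume "0 < t \<and> of_int h \<le> t \<and> t \<le> of_int p \<and> x = f t"
  then show "Upper_pt (Complex x t) \<in> orbifold_proj ` curve_over f h p"
    by (intro image_eqI[of _ _ "Complex (f t) t"]) (auto simp: orbifold_proj_def curve_over_def)
next
  assume "Upper_pt (Complex x t) \<in> orbifold_proj ` curve_over f h p"
  then obtain s where "of_int h \<le> s" "s \<le> of_int p"
    and s: "Upper_pt (Complex x t) = orbifold_proj (Complex (f s) s)" by (auto simp: curve_over_def)
  moreover have "0 \<le> s" using assms \<open>of_int h \<le> s\<close> by linarith
  ultimately show "0 < t \<and> of_int h \<le> t \<and> t \<le> of_int p \<and> x = f t"
    by (auto simp: orbifold_proj_def split: if_splits)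
qed

lemma Semicircle_pt_in_curve:
  assumes "0 \<le> h" "h \<le> p"
  shows "Semicircle_pt r \<in> orbifold_proj ` curve_over f h p \<longleftrightarrow> h = 0 \<and> r = \<bar>f 0\<bar>"
proof
  assume "h = 0 \<and> r = \<bar>f 0\<bar>"
  then show "Semicircle_pt r \<in> orbifold_proj ` curve_over f h p"
    using assms by (intro image_eqI[of _ _ "Complex (f 0) 0"]) (auto simp: orbifold_proj_def curve_over_def)
next
  assume "Semicircle_pt r \<in> orbifold_proj ` curve_over f h p"
  then obtain s where s: "of_int h \<le> s"
    "Semicircle_pt r = orbifold_proj (Complex (f s) s)" by (auto simp: curve_over_def)
  then have "s = 0" "r = \<bar>f s\<bar>" by (auto simp: orbifold_proj_def split: if_splits)
  then show "h = 0 \<and> r = \<bar>f 0\<bar>" using s(1) assms by auto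
qed

lemma ordinary_arc_points:
  assumes "ordinary_arc n p q f B"
  shows "Upper_pt (Complex x t) \<in> B \<longleftrightarrow> of_int q \<le> t \<and> t \<le> of_int p \<and> x = f t"
    and "Semicircle_pt r \<notin> B"
proof -
  have q: "1 \<le> q" "q < p" and B: "B = orbifold_proj ` curve_over f q p"
    using assms by (auto simp: ordinary_arc_def)
  have "0 < t" if "of_int q \<le> t" for t :: real using that q by linarith
  then show "Upper_pt (Complex x t) \<in> B \<longleftrightarrow> of_int q \<le> t \<and> t \<le> of_int p \<and> x = f t"
    using q unfolding B by (subst Upper_pt_in_curve) auto
  show "Semicircle_pt r \<notin> B"
    using q unfolding B by (subst Semicircle_pt_in_curve) auto
qed

lemma orbifold_arc_points:
  assumes "orbifold_arc n p f B"
  shows "Upper_pt (Complex x t) \<in> B \<longleftrightarrow> 0 < t \<and> t \<le> of_int p \<and> x = f t"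
    and "Semicircle_pt r \<in> B \<longleftrightarrow> r = 0"
  using assms by (auto simp: orbifold_arc_def Upper_pt_in_curve Semicircle_pt_in_curve)

lemma long_arc_points:
  assumes "long_arc n p q f g B"
  shows "Upper_pt (Complex x t) \<in> B \<longleftrightarrow>
      0 < t \<and> (t \<le> of_int p \<and> x = f t \<or> t \<le> of_int q \<and> x = g t)"
    and "Semicircle_pt r \<in> B \<longleftrightarrow> r = \<bar>f 0\<bar>"
  using assms unfolding long_arc_def Un_iff
  by (auto simp: Upper_pt_in_curve Semicircle_pt_in_curve)

lemma long_arc_disjoint:
  assumes "long_arc n p q f g B" "0 \<le> t" "t \<le> of_int q"
  shows "f t \<noteq> g t"
proof
  assume eq: "f t = g t"
  have "q < p" and disj: "curve_over f 0 p \<inter> curve_over g 0 q = {}"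
    using assms(1) by (auto simp: long_arc_def)
  then have "t \<le> of_int p" using assms(3) by linarith
  then have "Complex (f t) t \<in> curve_over f 0 p" "Complex (g t) t \<in> curve_over g 0 q"
    using assms(2,3) unfolding curve_over_def by (auto intro: imageI)
  then show False using disj eq by auto
qed

lemma continuous_nonzero_same_sign:
  fixes h :: "real \<Rightarrow> real"
  assumes "continuous_on {a..b} h" "a \<le> b" "\<And>s. a \<le> s \<Longrightarrow> s \<le> b \<Longrightarrow> h s \<noteq> 0"
  shows "0 < h a \<longleftrightarrow> 0 < h b"
proof (rule ccontr)
  assume "\<not> ?thesis"
  then have "h a \<le> 0 \<and> 0 \<le> h b \<or> h b \<le> 0 \<and> 0 \<le> h a" by auto
  then obtain s where "a \<le> s" "s \<le> b" "h s = 0"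
    using IVT'[of h a 0 b] IVT2'[of h b 0 a] assms(1,2) by blast
  then show False using assms(3) by blast
qed

text \<open>\<open>p\<close> is the greatest height of a point of \<open>B\<close>, and
  \<open>q\<close> the greatest height that carries two points. Exchanging the arcs gives the
  reverse inequalities.\<close>

lemma long_arc_unique_endpoints:
  assumes "long_arc n p q f g B" "long_arc n p' q' f' g' B"
  shows "p \<le> p'" "p \<le> p' \<Longrightarrow> p' \<le> p \<Longrightarrow> q \<le> q'"
proof -
  note points = long_arc_points[OF assms(1)] and points' = long_arc_points[OF assms(2)]
  have b: "1 \<le> q" "q < p" "1 \<le> q'" "q' < p'" and fp: "f (of_int p) = 0"
    using assms by (auto simp: long_arc_def descends_def)
  have "Upper_pt (Complex (f (of_int p)) (of_int p)) \<in> B" unfolding points using b by simp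
  then have "of_int p \<le> (of_int p' :: real) \<or> of_int p \<le> (of_int q' :: real)" unfolding points' by blast
  then show "p \<le> p'" using b by linarith
  show "q \<le> q'"
  proof (rule ccontr)
    assume "\<not> q \<le> q'"
    then have q: "\<not> of_int q \<le> (of_int q' :: real)" by simp
    have "Upper_pt (Complex (f (of_int q)) (of_int q)) \<in> B" "Upper_pt (Complex (g (of_int q)) (of_int q)) \<in> B"
      unfolding points using b by simp_all
    then have "f (of_int q) = g (of_int q)" unfolding points' using q by simp
    then show False using long_arc_disjoint[OF assms(1), of "of_int q"] b by simp
  qed
qed

text \<open>Below the lower endpoint \<open>q\<close> each height carries two points of the arc; which of them belongs
  to \<open>f\<close> is decided at height \<open>q\<close>, where \<open>g\<close> vanishes, and propagates downwards by continuity.\<close>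

lemma long_arc_unique_pieces:
  assumes arc: "long_arc n p q f g B" and arc': "long_arc n p q f' g' B"
  shows "0 < t \<Longrightarrow> t \<le> of_int p \<Longrightarrow> f t = f' t" "0 < t \<Longrightarrow> t \<le> of_int q \<Longrightarrow> g t = g' t"
proof -
  note points = long_arc_points[OF arc] and points' = long_arc_points[OF arc']
  have b: "1 \<le> q" "q < p" and gq: "g (of_int q) = 0" "g' (of_int q) = 0"
    and cont: "continuous_on {0..of_int p} f" "continuous_on {0..of_int q} g"
      "continuous_on {0..of_int p} f'" "continuous_on {0..of_int q} g'"
    using arc arc' by (auto simp: long_arc_def descends_def)
  have low: "f t = f' t \<and> g t = g' t" if t: "0 < t" "t \<le> of_int q" for t
  proof -
    have two: "(f s = f' s \<and> g s = g' s) \<or> (f s = g' s \<and> g s = f' s)" if "0 < s" "s \<le> of_int q" for s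
    proof -
      have "s \<le> of_int p" using that b by linarith
      then have "x = f s \<or> x = g s \<longleftrightarrow> x = f' s \<or> x = g' s" for x
        using points(1)[of x s] points'(1)[of x s] that by simp
      then have "f s = f' s \<or> f s = g' s" "g s = f' s \<or> g s = g' s" by blast+
      moreover have "f s \<noteq> g s" using long_arc_disjoint[OF arc, of s] that by simp
      ultimately show ?thesis by auto
    qed
    \<comment> \<open>The difference of the disjoint pieces keeps its sign from height
      \<open>q\<close> downwards, and at \<open>q\<close> the two differences agree; equal signs
      exclude an exchange of the pieces.\<close>
    let ?d = "\<lambda>s. f s - g s" and ?d' = "\<lambda>s. f' s - g' s"
    have sub: "{t..of_int q} \<subseteq> {0..of_int p}" "{t..of_int q} \<subseteq> {0..of_int q}"
      using t b by (auto intro: order_trans[of _ "of_int q"])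
    have "0 < ?d t \<longleftrightarrow> 0 < ?d (of_int q)"
      using t long_arc_disjoint[OF arc]
      by (intro continuous_nonzero_same_sign continuous_on_diff continuous_on_subset[OF cont(1) sub(1)]
          continuous_on_subset[OF cont(2) sub(2)]) auto
    moreover have "0 < ?d' t \<longleftrightarrow> 0 < ?d' (of_int q)"
      using t long_arc_disjoint[OF arc']
      by (intro continuous_nonzero_same_sign continuous_on_diff continuous_on_subset[OF cont(3) sub(1)]
          continuous_on_subset[OF cont(4) sub(2)]) auto
    moreover have "?d (of_int q) = ?d' (of_int q)"
      using two[of "of_int q"] gq b by auto
    ultimately have "0 < ?d t \<longleftrightarrow> 0 < ?d' t" by simp
    then show ?thesis using two[OF t] long_arc_disjoint[OF arc, of t] t by auto
  qed
  then show "0 < t \<Longrightarrow> t \<le> of_int q \<Longrightarrow> g t = g' t" by blast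
  show "f t = f' t" if t: "0 < t" "t \<le> of_int p"
  proof (cases "t \<le> of_int q")
    case False
    then show ?thesis using points(1)[of "f t" t] points'(1)[of "f t" t] t by simp
  qed (use low t in blast)
qed

lemma sides_cong:
  assumes "\<And>t. 0 < t \<Longrightarrow> of_int q < t \<Longrightarrow> t < of_int p \<Longrightarrow> f t = f' t"
    and "\<And>t. 0 < t \<Longrightarrow> t < - of_int q \<Longrightarrow> - of_int p < t \<Longrightarrow> g t = g' t"
  shows "sides n p q f g = sides n p q f' g'"
proof -
  have "(if 0 < i then 0 < f (of_int i) else g (of_int (- i)) < 0) \<longleftrightarrow>
    (if 0 < i then 0 < f' (of_int i) else g' (of_int (- i)) < 0)"
    if "i \<in> labels n" "q < i" "i < p" for i
  proof (cases "0 < i")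
    case False
    then have "0 < - i" using that(1) by (simp add: labels_def)
    then have "g (of_int (- i)) = g' (of_int (- i))"
      using that by (intro assms(2)) simp_all
    then show ?thesis using False by simp
  qed (use that assms(1)[of "of_int i"] in simp)
  then show ?thesis unfolding sides_def by blast
qed

text \<open>The semicircle points tell the kind: none for an ordinary arc, only radius 0 for an
  orbifold arc, one positive radius for a long arc. Within a kind, the heights give the endpoints,
  and the points give the functions at all heights that \<open>sides\<close> inspects.\<close>

lemma arc_data_unique:
  assumes "arc_data n B p q R" "arc_data n B p' q' R'"
  shows "p = p' \<and> q = q' \<and> R = R'"
proof -
  have kinds: "(\<exists>r. Semicircle_pt r \<in> B) \<longleftrightarrow> q < 0" "Semicircle_pt 0 \<in> B \<longleftrightarrow> q = - p"
    if "arc_data n B p q R" for p q R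
    using that unfolding arc_data_def
    by (auto simp: ordinary_arc_points orbifold_arc_points long_arc_points)
      (auto simp: ordinary_arc_def orbifold_arc_def long_arc_def)
  consider "0 < q" "0 < q'" | "q = - p" "q' = - p'" | "q < 0" "q \<noteq> - p" "q' < 0" "q' \<noteq> - p'"
  proof -
    have "q \<noteq> 0" "q' \<noteq> 0"
      using assms by (auto simp: arc_data_def ordinary_arc_def orbifold_arc_def long_arc_def)
    then show ?thesis using kinds[OF assms(1)] kinds[OF assms(2)] that by force
  qed
  then show ?thesis
  proof cases
    case 1
    obtain f f' where arc: "ordinary_arc n p q f B" "ordinary_arc n p' q' f' B"
      and R: "R = sides n p q f f" "R' = sides n p' q' f' f'"
      using assms by (auto simp: ordinary_arc_data_iff 1)
    have iff: "of_int q \<le> t \<and> t \<le> of_int p \<and> x = f t \<longleftrightarrow> of_int q' \<le> t \<and> t \<le> of_int p' \<and> x = f' t" for x t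
      using ordinary_arc_points(1)[OF arc(1)] ordinary_arc_points(1)[OF arc(2)] by metis
    have "q < p" "q' < p'" using arc by (auto simp: ordinary_arc_def)
    then have eq: "p = p'" "q = q'"
      using iff[of "of_int p" "f (of_int p)"] iff[of "of_int q" "f (of_int q)"]
        iff[of "of_int p'" "f' (of_int p')"] iff[of "of_int q'" "f' (of_int q')"] by auto
    moreover have "f t = f' t" if "of_int q < t" "t < of_int p" for t
      using iff[of t "f t"] that by simp
    then have "R = R'" unfolding R eq[symmetric] using 1 by (intro sides_cong) auto
    ultimately show ?thesis by simp
  next
    case 2
    obtain f f' where arc: "orbifold_arc n p f B" "orbifold_arc n p' f' B"
      and R: "R = sides n p (- p) f f" "R' = sides n p' (- p') f' f'"
      using assms by (auto simp: orbifold_arc_data_iff 2)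
    have iff: "0 < t \<and> t \<le> of_int p \<and> x = f t \<longleftrightarrow> 0 < t \<and> t \<le> of_int p' \<and> x = f' t" for x t
      using orbifold_arc_points(1)[OF arc(1)] orbifold_arc_points(1)[OF arc(2)] by metis
    have "1 \<le> p" "1 \<le> p'" using arc by (auto simp: orbifold_arc_def)
    then have eq: "p = p'"
      using iff[of "of_int p" "f (of_int p)"] iff[of "of_int p'" "f' (of_int p')"] by auto
    moreover have "f t = f' t" if "0 < t" "t < of_int p" for t
      using iff[of t "f t"] that by simp
    then have "R = R'" unfolding R eq[symmetric] by (intro sides_cong) auto
    ultimately show ?thesis using 2 by simp
  next
    case 3
    obtain f g f' g' where arc: "long_arc n p (- q) f g B" "long_arc n p' (- q') f' g' B"
      and R: "R = sides n p q f g" "R' = sides n p' q' f' g'"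
      using assms by (auto simp: long_arc_data_iff 3)
    have p: "p = p'"
      using long_arc_unique_endpoints(1)[OF arc] long_arc_unique_endpoints(1)[OF arc(2,1)] by simp
    have q: "q = q'"
      using long_arc_unique_endpoints(2)[OF arc] long_arc_unique_endpoints(2)[OF arc(2,1)] p by simp
    have "R = R'" unfolding R p[symmetric] q[symmetric]
      using long_arc_unique_pieces[OF arc(1) arc(2)[folded p q]] by (intro sides_cong) auto
    then show ?thesis using p q by simp
  qed
qed

lemma type_B_arc_equiv_class:
  "arc_data n B p q R \<Longrightarrow> type_B_arc_equiv n `` {B} = {B'. arc_data n B' p q R}"
  using arc_data_unique unfolding Image_singleton type_B_arc_equiv_iff by blast

section \<open>Drawings\<close>

lemma curve_over_eq_bounds:
  assumes "curve_over f h p = curve_over f' h' p'" "h < p" "h' < p'"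
  shows "h = h'" "p = p'"
proof -
  have Im: "Im ` curve_over f h p = {of_int h..of_int p}" for f :: "real \<Rightarrow> real" and h p
    unfolding curve_over_def image_image by simp
  have "{of_int h..of_int p} = {of_int h'..of_int p' :: real}"
    by (metis Im assms(1))
  then show "h = h'" "p = p'"
    using assms(2,3) by (auto simp: Icc_eq_Icc)
qed

lemma uminus_curve_over: "uminus ` curve_over f h p = curve_over (\<lambda>t. - f (- t)) (- p) (- h)"
proof -
  have eq: "{of_int (- p)..of_int (- h)} = uminus ` {of_int h..of_int p :: real}" by simp
  show ?thesis
    unfolding curve_over_def eq image_image by (intro image_cong) (auto simp: complex_eq_iff)
qed

lemma orbifold_proj_uminus_image: "orbifold_proj ` uminus ` C = orbifold_proj ` C"
  unfolding image_image by (intro image_cong refl) (simp add: orbifold_proj_eq_iff)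

text \<open>Central symmetry only says that the negative of a curve is some curve of the drawing;
  the heights of its ends identify the descent it belongs to.\<close>

lemma symmetric_diagram_uminus:
  assumes \<sigma>: "\<sigma> \<in> signed_perms n"
    and K: "\<And>d. d \<in> descents n \<sigma> \<Longrightarrow> descent_arc n \<sigma> d (K d)"
    and sym: "\<And>C. C \<in> K ` descents n \<sigma> \<Longrightarrow> uminus ` C \<in> K ` descents n \<sigma>"
    and ab: "(a, b) \<in> descents n \<sigma>"
  shows "uminus ` K (a, b) = K (- b, - a)"
proof -
  obtain c d where cd: "(c, d) \<in> descents n \<sigma>" "uminus ` K (a, b) = K (c, d)"
    using sym[of "K (a, b)"] ab by auto
  obtain f where f: "K (a, b) = curve_over f (\<sigma> b) (\<sigma> a)"
    using K[OF ab] by (auto simp: descent_arc_def)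
  obtain g where g: "K (c, d) = curve_over g (\<sigma> d) (\<sigma> c)"
    using K[OF cd(1)] by (auto simp: descent_arc_def)
  have eq: "curve_over (\<lambda>t. - f (- t)) (- \<sigma> a) (- \<sigma> b) = curve_over g (\<sigma> d) (\<sigma> c)"
    using cd(2) unfolding f g uminus_curve_over .
  have "- \<sigma> a = \<sigma> d" "- \<sigma> b = \<sigma> c"
    using curve_over_eq_bounds[OF eq] ab cd(1) by (auto simp: descents_def)
  then have "\<sigma> d = \<sigma> (- a)" "\<sigma> c = \<sigma> (- b)"
    by (simp_all add: signed_perms_uminus[OF \<sigma>])
  then have "d = - a" "c = - b" by (simp_all only: signed_perms_eq_iff[OF \<sigma>])
  then show ?thesis using cd(2) by simp
qed

lemma left_values_eq_positive:
  fixes f :: "real \<Rightarrow> real"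
  assumes \<sigma>: "\<sigma> \<in> signed_perms n" and ab: "(a, b) \<in> descents n \<sigma>"
    and sides: "\<forall>c\<in>labels n. \<sigma> b < \<sigma> c \<and> \<sigma> c < \<sigma> a \<longrightarrow>
        (c < a \<longrightarrow> f (of_int (\<sigma> c)) > 0) \<and> (b < c \<longrightarrow> f (of_int (\<sigma> c)) < 0)"
  shows "left_values n \<sigma> a b = {v \<in> labels n. \<sigma> b < v \<and> v < \<sigma> a \<and> 0 < f (of_int v)}"
proof -
  have "inv \<sigma> v < a \<longleftrightarrow> 0 < f (of_int v)" if v: "v \<in> labels n" "\<sigma> b < v" "v < \<sigma> a" for v
  proof -
    have c: "inv \<sigma> v \<in> labels n" "\<sigma> (inv \<sigma> v) = v"
      using v(1) signed_perms_in_labels[OF signed_perms_inv[OF \<sigma>]] signed_perms_inverses(2)[OF \<sigma>] by simp_all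
    then have "inv \<sigma> v \<noteq> a" "inv \<sigma> v \<noteq> b" using v by auto
    then have "inv \<sigma> v < a \<or> b < inv \<sigma> v"
      using descents_consecutive[OF ab c(1)] by linarith
    moreover have "inv \<sigma> v < a \<longrightarrow> 0 < f (of_int v)" "b < inv \<sigma> v \<longrightarrow> f (of_int v) < 0"
      using sides[rule_format, OF c(1)] v unfolding c(2) by blast+
    moreover have "a < b" using ab by (simp add: descents_def)
    ultimately show ?thesis by auto
  qed
  then show ?thesis unfolding left_values_def by blast
qed

text \<open>An arc with both ends above the axis is unchanged by folding. One that crosses the axis
  is cut at height 0, and its lower half is rotated into a second piece. Symmetry of the drawing
  then yields the orbifold arc when the ends are opposite; otherwise the arc does not cross its own
  mirror image, which makes the two pieces of the long arc disjoint.\<close>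

lemma descent_arc_data:
  assumes \<sigma>: "\<sigma> \<in> signed_perms n"
    and K: "\<And>d. d \<in> descents n \<sigma> \<Longrightarrow> descent_arc n \<sigma> d (K d)"
    and sym: "\<And>C. C \<in> K ` descents n \<sigma> \<Longrightarrow> uminus ` C \<in> K ` descents n \<sigma>"
    and cross: "\<And>C C'. \<lbrakk>C \<in> K ` descents n \<sigma>; C' \<in> K ` descents n \<sigma>; C \<noteq> C'\<rbrakk> \<Longrightarrow>
      C \<inter> C' \<subseteq> label_point ` labels n"
    and ab: "(a, b) \<in> descents n \<sigma>" and normal: "0 \<le> \<sigma> a + \<sigma> b"
  shows "arc_data n (orbifold_proj ` K (a, b)) (\<sigma> a) (\<sigma> b) (left_values n \<sigma> a b)"
proof -
  define p where "p = \<sigma> a"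
  define q where "q = \<sigma> b"
  obtain f where f: "descends n p q f" "f (of_int q) = 0" and C: "K (a, b) = curve_over f q p"
    and sides: "\<forall>c\<in>labels n. \<sigma> b < \<sigma> c \<and> \<sigma> c < \<sigma> a \<longrightarrow>
        (c < a \<longrightarrow> f (of_int (\<sigma> c)) > 0) \<and> (b < c \<longrightarrow> f (of_int (\<sigma> c)) < 0)"
    using K[OF ab] by (auto simp: descent_arc_def p_def q_def)
  have R: "left_values n \<sigma> a b = {v \<in> labels n. q < v \<and> v < p \<and> 0 < f (of_int v)}"
    unfolding p_def q_def by (rule left_values_eq_positive[OF \<sigma> ab sides])
  have pq: "q < p" "p \<in> labels n" "q \<in> labels n" "0 \<le> p + q"
    using ab normal by (auto simp: p_def q_def descents_def signed_perms_in_labels[OF \<sigma>])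
  have p: "1 \<le> p" "p \<le> int n" using pq by (auto simp: labels_def)
  have "arc_data n (orbifold_proj ` K (a, b)) p q (left_values n \<sigma> a b)"
  proof (cases "0 < q")
    case True
    then have "left_values n \<sigma> a b = sides n p q f f" unfolding R sides_def by auto
    moreover have "ordinary_arc n p q f (orbifold_proj ` K (a, b))"
      using True p pq f unfolding C ordinary_arc_def by simp
    ultimately show ?thesis unfolding ordinary_arc_data_iff[OF True] by blast
  next
    case False
    then have q: "q < 0" using pq(3) by (auto simp: labels_def)
    define g where "g t = - f (- t)" for t
    have Cu: "uminus ` K (a, b) = curve_over g (- p) (- q)"
      unfolding C uminus_curve_over g_def ..
    \<comment> \<open>The lower half projects to the same points as its half-turn image, the graph
      of \<open>g\<close>.\<close>
    have split: "orbifold_proj ` K (a, b) =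
      orbifold_proj ` curve_over f 0 p \<union> orbifold_proj ` curve_over g 0 (- q)"
    proof -
      have "{of_int q..of_int p} = {of_int q..0} \<union> {0..of_int p :: real}" using q p by auto
      then have "K (a, b) = curve_over f q 0 \<union> curve_over f 0 p"
        unfolding C curve_over_def by (simp add: image_Un)
      moreover have "uminus ` curve_over f q 0 = curve_over g 0 (- q)"
        unfolding uminus_curve_over g_def by simp
      ultimately show ?thesis
        using orbifold_proj_uminus_image[of "curve_over f q 0"] by (auto simp: image_Un)
    qed
    have cont: "continuous_on {of_int q..of_int p} f" and nz: "\<And>i. \<lbrakk>i \<in> labels n; q < i; i < p\<rbrakk> \<Longrightarrow> f (of_int i) \<noteq> 0"
      and fp: "f (of_int p) = 0" using f(1) by (auto simp: descends_def)
    have df: "descends n p 0 f"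
      unfolding descends_def using nz fp q by (auto intro: continuous_on_subset[OF cont])
    have "continuous_on {0..of_int (- q)} g"
      unfolding g_def using q p
      by (intro continuous_intros continuous_on_compose2[OF cont]) auto
    moreover have "g (of_int i) \<noteq> 0" if "i \<in> labels n" "0 < i" "i < - q" for i
      using nz[of "- i"] that p by (simp add: g_def)
    ultimately have dg: "descends n (- q) 0 g"
      unfolding descends_def using f(2) by (auto simp: g_def)
    have Rs: "left_values n \<sigma> a b = sides n p q f g" unfolding R sides_def g_def by auto
    show ?thesis
    proof (cases "q = - p")
      case True
      have "\<sigma> b = \<sigma> (- a)" using True by (simp add: p_def q_def signed_perms_uminus[OF \<sigma>])
      then have "b = - a" by (simp only: signed_perms_eq_iff[OF \<sigma>])
      then have "uminus ` K (a, b) = K (a, b)"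
        using symmetric_diagram_uminus[OF \<sigma> K sym ab] by simp
      then have same: "curve_over g (- p) p = curve_over f (- p) p" using Cu C True by simp
      \<comment> \<open>A symmetric curve is the graph of an odd function, so it passes through the
        origin, which projects to the orbifold point.\<close>
      have gf: "g t = f t" if "- of_int p \<le> t" "t \<le> of_int p" for t
      proof -
        have "Complex (g t) t \<in> curve_over g (- p) p" using that by (simp add: curve_over_def)
        then have "Complex (g t) t \<in> curve_over f (- p) p" unfolding same .
        then show ?thesis by (auto simp: curve_over_def)
      qed
      have "f 0 = 0" using gf[of 0] p by (simp add: g_def)
      moreover have "curve_over g 0 p = curve_over f 0 p"
        unfolding curve_over_def using gf by (intro image_cong) auto
      ultimately have "orbifold_arc n p f (orbifold_proj ` K (a, b))"
        unfolding orbifold_arc_def split using True p df by simp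
      moreover have "sides n p q f g = sides n p (- p) f f"
        unfolding True using gf by (intro sides_cong) auto
      ultimately show ?thesis unfolding Rs True orbifold_arc_data_iff by blast
    next
      case False
      then have less: "- q < p" using pq(4) by simp
      have in_D: "K (a, b) \<in> K ` descents n \<sigma>" using ab by blast
      have "uminus ` K (a, b) \<noteq> K (a, b)"
      proof
        assume "uminus ` K (a, b) = K (a, b)"
        then have "curve_over g (- p) (- q) = curve_over f q p" using Cu C by simp
        from curve_over_eq_bounds(1)[OF this] show False using pq(1) False by simp
      qed
      then have cr: "K (a, b) \<inter> uminus ` K (a, b) \<subseteq> label_point ` labels n"
        using cross[OF in_D sym[OF in_D]] by metis
      \<comment> \<open>The origin is fixed by the half-turn, so an arc through it would meet its
        mirror image at a point without a label.\<close>
      have zero: "f 0 \<noteq> 0"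
      proof
        assume "f 0 = 0"
        then have "Complex 0 0 \<in> K (a, b)" unfolding C curve_over_def
          using q p by (auto intro!: image_eqI[of _ _ 0])
        moreover have "Complex 0 0 \<in> uminus ` K (a, b)"
          using calculation by (intro image_eqI[of _ _ "Complex 0 0"]) (auto simp: complex_eq_iff)
        ultimately have "Complex 0 0 \<in> label_point ` labels n" using cr by blast
        then show False by (auto simp: label_point_def labels_def)
      qed
      \<comment> \<open>A common point would be a labeled point at a height above 0 and below
        \<open>p\<close>, where \<open>descends\<close> forbids a zero of \<open>f\<close>.\<close>
      have disj: "curve_over f 0 p \<inter> curve_over g 0 (- q) = {}"
      proof (rule ccontr)
        assume "curve_over f 0 p \<inter> curve_over g 0 (- q) \<noteq> {}"
        then obtain t where t: "0 \<le> t" "t \<le> of_int p" "t \<le> of_int (- q)"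
          and z: "Complex (f t) t = Complex (g t) t" by (auto simp: curve_over_def)
        have "Complex (f t) t \<in> K (a, b)"
          unfolding C curve_over_def using t q by auto
        moreover have "Complex (f t) t \<in> uminus ` K (a, b)"
          unfolding Cu z curve_over_def using t p by auto
        ultimately have "Complex (f t) t \<in> label_point ` labels n" using cr by blast
        then obtain i where i: "i \<in> labels n" "f t = 0" "t = of_int i"
          by (auto simp: label_point_def)
        have "0 < i" using i t(1) by (auto simp: labels_def)
        moreover have "i < p" using i(3) t(3) less by linarith
        ultimately show False using nz[OF i(1)] q i by simp
      qed
      have "long_arc n p (- q) f g (orbifold_proj ` K (a, b))"
        unfolding long_arc_def using split q less p df dg zero disj by (simp add: g_def)
      then show ?thesis unfolding Rs long_arc_data_iff[OF q False] by blast
    qed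
  qed
  then show ?thesis by (simp add: p_def q_def)
qed

section \<open>A piecewise linear symmetric drawing\<close>

text \<open>The drawing: at the height of the value in position \<open>c\<close>, the arc of the descent
  \<open>(a, b)\<close> has horizontal coordinate \<open>a + b - 2 c\<close>, corrected to \<open>0\<close> at its endpoints, and it is
  interpolated linearly between integer heights. Arcs of earlier descents then run to the left of
  arcs of later ones.\<close>

definition arc_coordinate :: "(int \<Rightarrow> int) \<Rightarrow> int \<times> int \<Rightarrow> int \<Rightarrow> int" where
  "arc_coordinate \<sigma> = (\<lambda>(a, b) k. if inv \<sigma> k = a \<or> inv \<sigma> k = b then 0 else a + b - 2 * inv \<sigma> k)"

definition hat :: "real \<Rightarrow> real" where
  "hat t = max 0 (1 - \<bar>t\<bar>)"

text \<open>The sum includes height 0 although it has no label: \<open>inv \<sigma> 0 = 0\<close>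
  makes it a position in the middle, where the arc of a descent \<open>(a, b)\<close> has coordinate
  \<open>a + b\<close>. This vanishes exactly for the central descent.\<close>

definition interpolate :: "nat \<Rightarrow> (int \<Rightarrow> int) \<Rightarrow> real \<Rightarrow> real" where
  "interpolate n h t = (\<Sum>k\<in>{- int n..int n}. of_int (h k) * hat (t - of_int k))"

lemma hat_nonneg: "0 \<le> hat t"
  by (simp add: hat_def)

lemma hat_uminus: "hat (- t) = hat t"
  by (simp add: hat_def)

lemma hat_of_int: "hat (of_int i - of_int k) = (if i = k then 1 else 0)"
proof (cases "i = k")
  case False
  then have "1 \<le> \<bar>of_int i - of_int k :: real\<bar>" by linarith
  then show ?thesis using False by (simp add: hat_def)
qed (simp add: hat_def)

lemma continuous_on_interpolate: "continuous_on S (interpolate n h)"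
  unfolding interpolate_def hat_def by (intro continuous_intros)

lemma interpolate_of_int:
  assumes "\<bar>i\<bar> \<le> int n"
  shows "interpolate n h (of_int i) = of_int (h i)"
proof -
  have "interpolate n h (of_int i) = (\<Sum>k\<in>{- int n..int n}. if i = k then of_int (h k) else 0)"
    unfolding interpolate_def hat_of_int by (intro sum.cong) auto
  moreover have "- int n \<le> i" "i \<le> int n" using assms by linarith+
  ultimately show ?thesis by simp
qed

lemma interpolate_uminus:
  assumes "\<And>k. h' (- k) = - h k"
  shows "interpolate n h' (- t) = - interpolate n h t"
proof -
  have "interpolate n h' (- t) = (\<Sum>k\<in>{- int n..int n}. of_int (h' (- k)) * hat (- t - of_int (- k)))"
    unfolding interpolate_def by (rule sum.reindex_bij_witness[of _ uminus uminus]) auto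
  also have "\<dots> = (\<Sum>k\<in>{- int n..int n}. - (of_int (h k) * hat (t - of_int k)))"
  proof (rule sum.cong)
    fix k
    have "- t - of_int (- k) = - (t - of_int k)" by simp
    then show "of_int (h' (- k)) * hat (- t - of_int (- k)) = - (of_int (h k) * hat (t - of_int k))"
      unfolding assms by (simp only: hat_uminus)
  qed simp
  finally show ?thesis by (simp add: interpolate_def sum_negf)
qed

lemma interpolate_less:
  assumes le: "\<And>k. h k \<le> h' k" and k: "\<bar>k\<bar> \<le> int n" "h k < h' k" "\<bar>t - of_int k\<bar> < 1"
  shows "interpolate n h t < interpolate n h' t"
  unfolding interpolate_def
proof (rule sum_strict_mono_ex1)
  show "\<forall>k\<in>{- int n..int n}. of_int (h k) * hat (t - of_int k) \<le> of_int (h' k) * hat (t - of_int k)"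
    using le hat_nonneg by (simp add: mult_right_mono)
  have "0 < hat (t - of_int k)" using k(3) by (simp add: hat_def)
  then show "\<exists>k\<in>{- int n..int n}. of_int (h k) * hat (t - of_int k) < of_int (h' k) * hat (t - of_int k)"
    using k(1,2) by (intro bexI[of _ k]) auto
qed simp

text \<open>At a non-integer height both neighbouring integers have positive weight, so agreement of
  ordered interpolants there would force agreement at two integers.\<close>

lemma interpolate_eq_imp:
  assumes le: "\<And>k. h k \<le> h' k" and inj: "\<And>k l. h k = h' k \<Longrightarrow> h l = h' l \<Longrightarrow> k = l"
    and t: "\<bar>t\<bar> \<le> of_nat n" and eq: "interpolate n h t = interpolate n h' t"
  obtains k where "t = of_int k" "h k = h' k"
proof -
  have same: "h k = h' k" if "\<bar>k\<bar> \<le> int n" "\<bar>t - of_int k\<bar> < 1" for k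
  proof (rule ccontr)
    assume "h k \<noteq> h' k"
    then have "h k < h' k" using le[of k] by simp
    then show False using interpolate_less[of h h' k n t, OF le that(1) _ that(2)] eq by simp
  qed
  show ?thesis
  proof (cases "t = of_int \<lfloor>t\<rfloor>")
    case True
    have "\<bar>\<lfloor>t\<rfloor>\<bar> \<le> int n" using t True by linarith
    then show ?thesis using that[OF True] same[of "\<lfloor>t\<rfloor>"] True by simp
  next
    case False
    then have lt: "of_int \<lfloor>t\<rfloor> < t" "t < of_int (\<lfloor>t\<rfloor> + 1)" by linarith+
    have "\<bar>\<lfloor>t\<rfloor>\<bar> \<le> int n" "\<bar>\<lfloor>t\<rfloor> + 1\<bar> \<le> int n" using t lt by linarith+
    moreover have "\<bar>t - of_int \<lfloor>t\<rfloor>\<bar> < 1" "\<bar>t - of_int (\<lfloor>t\<rfloor> + 1)\<bar> < 1"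
      using lt by linarith+
    ultimately have "h \<lfloor>t\<rfloor> = h' \<lfloor>t\<rfloor>" "h (\<lfloor>t\<rfloor> + 1) = h' (\<lfloor>t\<rfloor> + 1)"
      using same by blast+
    then have "\<lfloor>t\<rfloor> = \<lfloor>t\<rfloor> + 1" by (rule inj)
    then show ?thesis by simp
  qed
qed

text \<open>Measuring positions from the midpoint of the descent makes \<open>a + b - 2 * c\<close>
  change sign when descent and position are mirrored; this is what makes the drawing centrally
  symmetric.\<close>

lemma arc_coordinate_uminus:
  assumes "\<sigma> \<in> signed_perms n"
  shows "arc_coordinate \<sigma> (- b, - a) (- k) = - arc_coordinate \<sigma> (a, b) k"
  by (auto simp: arc_coordinate_def signed_perms_inv_uminus[OF assms])

lemma arc_coordinate_apply:
  assumes "\<sigma> \<in> signed_perms n"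
  shows "arc_coordinate \<sigma> (a, b) (\<sigma> c) = (if c = a \<or> c = b then 0 else a + b - 2 * c)"
  by (simp add: arc_coordinate_def signed_perms_inverses(1)[OF assms])

text \<open>At an end of one arc the other coordinate is nonzero of the right sign, so the
  correction to 0 keeps the inequality strict, except at a position shared by two adjacent descents,
  where both arcs end.\<close>

lemma arc_coordinate_mono:
  assumes "(a, b) \<in> descents n \<sigma>" "(c, d) \<in> descents n \<sigma>" "a < c"
  shows "arc_coordinate \<sigma> (a, b) k \<le> arc_coordinate \<sigma> (c, d) k"
    and "arc_coordinate \<sigma> (a, b) k = arc_coordinate \<sigma> (c, d) k \<Longrightarrow> inv \<sigma> k = b \<and> b = c"
proof -
  have "a < b" "b \<le> c" "c < d"
    using assms descents_consecutive[OF assms(1), of c] by (auto simp: descents_def)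
  then show "arc_coordinate \<sigma> (a, b) k \<le> arc_coordinate \<sigma> (c, d) k"
    and "arc_coordinate \<sigma> (a, b) k = arc_coordinate \<sigma> (c, d) k \<Longrightarrow> inv \<sigma> k = b \<and> b = c"
    unfolding arc_coordinate_def by (auto split: if_splits)
qed

lemma descent_arc_interpolate:
  assumes \<sigma>: "\<sigma> \<in> signed_perms n" and ab: "(a, b) \<in> descents n \<sigma>"
  shows "descent_arc n \<sigma> (a, b) (curve_over (interpolate n (arc_coordinate \<sigma> (a, b))) (\<sigma> b) (\<sigma> a))"
proof -
  let ?f = "interpolate n (arc_coordinate \<sigma> (a, b))"
  have lt: "a < b" and lab: "a \<in> labels n" "b \<in> labels n" using ab by (auto simp: descents_def)
  have f: "?f (of_int v) = of_int (arc_coordinate \<sigma> (a, b) v)" if "v \<in> labels n" for v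
    using that by (intro interpolate_of_int) (simp add: labels_def)
  have zero: "?f (of_int (\<sigma> a)) = 0" "?f (of_int (\<sigma> b)) = 0"
    using lab by (simp_all add: f signed_perms_in_labels[OF \<sigma>] arc_coordinate_apply[OF \<sigma>])
  have side: "(c < a \<longrightarrow> 0 < ?f (of_int (\<sigma> c))) \<and> (b < c \<longrightarrow> ?f (of_int (\<sigma> c)) < 0)"
    if "c \<in> labels n" for c
    using that lt by (auto simp: f signed_perms_in_labels[OF \<sigma>] arc_coordinate_apply[OF \<sigma>])
  have nonzero: "?f (of_int i) \<noteq> 0" if i: "i \<in> labels n" "\<sigma> b < i" "i < \<sigma> a" for i
  proof -
    have c: "inv \<sigma> i \<in> labels n" "\<sigma> (inv \<sigma> i) = i"
      using i(1) signed_perms_in_labels[OF signed_perms_inv[OF \<sigma>]] signed_perms_inverses(2)[OF \<sigma>] by simp_all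
    then have "inv \<sigma> i \<noteq> a" "inv \<sigma> i \<noteq> b" using i by auto
    then have "inv \<sigma> i < a \<or> b < inv \<sigma> i"
      using descents_consecutive[OF ab c(1)] by linarith
    then show ?thesis using side[OF c(1)] unfolding c(2) by auto
  qed
  have "descends n (\<sigma> a) (\<sigma> b) ?f"
    unfolding descends_def using continuous_on_interpolate zero(1) nonzero by blast
  then show ?thesis
    unfolding descent_arc_def case_prod_conv using zero(2) side by blast
qed

lemma ex_symmetric_diagram:
  assumes \<sigma>: "\<sigma> \<in> signed_perms n"
  shows "\<exists>D. symmetric_diagram n \<sigma> D"
proof -
  define f where "f d = interpolate n (arc_coordinate \<sigma> d)" for d
  define K where "K = (\<lambda>(a, b). curve_over (f (a, b)) (\<sigma> b) (\<sigma> a))"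
  have arc: "descent_arc n \<sigma> d (K d)" if "d \<in> descents n \<sigma>" for d
    using descent_arc_interpolate[OF \<sigma>] that by (cases d) (simp add: K_def f_def)
  have mirror: "uminus ` K (a, b) = K (- b, - a)" for a b
  proof -
    have "f (- b, - a) t = - f (a, b) (- t)" for t
      using interpolate_uminus[of "arc_coordinate \<sigma> (- b, - a)" "arc_coordinate \<sigma> (a, b)" n "- t"]
        arc_coordinate_uminus[OF \<sigma>] by (simp add: f_def)
    then have "f (- b, - a) = (\<lambda>t. - f (a, b) (- t))" by blast
    then show ?thesis
      by (simp add: K_def uminus_curve_over signed_perms_uminus[OF \<sigma>])
  qed
  have cross: "K (a, b) \<inter> K (c, d) \<subseteq> label_point ` labels n"
    if ab: "(a, b) \<in> descents n \<sigma>" and cd: "(c, d) \<in> descents n \<sigma>" and "a < c" for a b c d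
  proof
    fix z assume "z \<in> K (a, b) \<inter> K (c, d)"
    then obtain t where t: "of_int (\<sigma> b) \<le> t" "t \<le> of_int (\<sigma> a)"
      and z: "z = Complex (f (a, b) t) t" "f (a, b) t = f (c, d) t"
      by (auto simp: K_def curve_over_def)
    have lab: "\<sigma> a \<in> labels n" "\<sigma> b \<in> labels n" and "b \<in> labels n"
      using ab by (auto simp: descents_def signed_perms_in_labels[OF \<sigma>])
    have "\<bar>t\<bar> \<le> of_nat n" using t lab unfolding labels_def by auto
    then obtain k where k: "t = of_int k" "arc_coordinate \<sigma> (a, b) k = arc_coordinate \<sigma> (c, d) k"
    proof (rule interpolate_eq_imp[rotated 2])
      show "interpolate n (arc_coordinate \<sigma> (a, b)) t = interpolate n (arc_coordinate \<sigma> (c, d)) t"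
        using z(2) by (simp add: f_def)
      show "arc_coordinate \<sigma> (a, b) k \<le> arc_coordinate \<sigma> (c, d) k" for k
        by (rule arc_coordinate_mono(1)[OF ab cd \<open>a < c\<close>])
      show "k = l" if "arc_coordinate \<sigma> (a, b) k = arc_coordinate \<sigma> (c, d) k"
        "arc_coordinate \<sigma> (a, b) l = arc_coordinate \<sigma> (c, d) l" for k l
        using arc_coordinate_mono(2)[OF ab cd \<open>a < c\<close> that(1)]
          arc_coordinate_mono(2)[OF ab cd \<open>a < c\<close> that(2)]
          inv_eq_signed_perms[OF \<sigma>, of k b] inv_eq_signed_perms[OF \<sigma>, of l b] by simp
    qed
    \<comment> \<open>Two arcs can agree only at the value of a shared position, and both
      coordinates are 0 there.\<close>
    have inv_k: "inv \<sigma> k = b" using arc_coordinate_mono(2)[OF ab cd \<open>a < c\<close> k(2)] by blast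
    then have "k = \<sigma> b" using inv_eq_signed_perms[OF \<sigma>, of k b] by blast
    moreover have "f (a, b) t = 0"
      using inv_k lab calculation unfolding k(1) f_def
      by (subst interpolate_of_int) (auto simp: labels_def arc_coordinate_def)
    ultimately show "z \<in> label_point ` labels n"
      using z(1) k(1) lab(2) by (simp add: label_point_def)
  qed
  have "symmetric_diagram n \<sigma> (K ` descents n \<sigma>)"
    unfolding symmetric_diagram_def
  proof (intro conjI ballI impI)
    show "\<exists>K'. (\<forall>d\<in>descents n \<sigma>. descent_arc n \<sigma> d (K' d)) \<and> K ` descents n \<sigma> = K' ` descents n \<sigma>"
      using arc by blast
    fix C assume "C \<in> K ` descents n \<sigma>"
    then obtain a b where ab: "(a, b) \<in> descents n \<sigma>" "C = K (a, b)" by auto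
    then show "uminus ` C \<in> K ` descents n \<sigma>"
      using mirror descents_uminus[OF \<sigma>, of b a] by auto
    fix C' assume "C' \<in> K ` descents n \<sigma>" "C \<noteq> C'"
    then obtain c d where cd: "(c, d) \<in> descents n \<sigma>" "C' = K (c, d)" by auto
    have "a \<noteq> c"
    proof
      assume "a = c"
      then have "b = d"
        using descents_consecutive[OF ab(1), of d] descents_consecutive[OF cd(1), of b] ab(1) cd(1)
        by (auto simp: descents_def)
      then show False using \<open>a = c\<close> \<open>C \<noteq> C'\<close> ab cd by simp
    qed
    then consider "a < c" | "c < a" by linarith
    then show "C \<inter> C' \<subseteq> label_point ` labels n"
      using cross[OF ab(1) cd(1)] cross[OF cd(1) ab(1)] ab(2) cd(2) by cases auto
  qed
  then show ?thesis by blast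
qed

lemma symmetric_diagram_obtain:
  assumes \<sigma>: "\<sigma> \<in> signed_perms n" and D: "symmetric_diagram n \<sigma> D"
  obtains K where "D = K ` descents n \<sigma>"
    "\<And>a b. (a, b) \<in> descents n \<sigma> \<Longrightarrow> uminus ` K (a, b) = K (- b, - a)"
    "\<And>a b. \<lbrakk>(a, b) \<in> descents n \<sigma>; 0 \<le> \<sigma> a + \<sigma> b\<rbrakk> \<Longrightarrow>
      arc_data n (orbifold_proj ` K (a, b)) (\<sigma> a) (\<sigma> b) (left_values n \<sigma> a b)"
proof -
  note D = D[unfolded symmetric_diagram_def]
  from D obtain K where K: "\<forall>d\<in>descents n \<sigma>. descent_arc n \<sigma> d (K d)" and D_eq: "D = K ` descents n \<sigma>"
    by (elim conjE exE)
  have K: "descent_arc n \<sigma> d (K d)" if "d \<in> descents n \<sigma>" for d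
    by (rule bspec[OF K that])
  have sym: "uminus ` C \<in> K ` descents n \<sigma>" if "C \<in> K ` descents n \<sigma>" for C
    using D[THEN conjunct2, THEN conjunct1] that unfolding D_eq by (rule bspec)
  have cross: "C \<inter> C' \<subseteq> label_point ` labels n"
    if "C \<in> K ` descents n \<sigma>" "C' \<in> K ` descents n \<sigma>" "C \<noteq> C'" for C C'
    using D[THEN conjunct2, THEN conjunct2, unfolded D_eq, THEN bspec, THEN bspec, THEN mp] that by blast
  show ?thesis
    by (rule that[OF D_eq symmetric_diagram_uminus[OF \<sigma> K sym] descent_arc_data[OF \<sigma> K sym cross]])
qed

text \<open>A curve and its mirror image have the same projection, and the data of a normalized arc
  depend on its descent alone; hence every drawing yields the same classes. The second claim
  provides members of the classes, without which distinct triples could share an empty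
  class.\<close>

lemma orbifold_diagram_eq:
  assumes \<sigma>: "\<sigma> \<in> signed_perms n"
  shows "orbifold_diagram n \<sigma> = (\<lambda>(p, q, R). {B. arc_data n B p q R}) ` arcs n \<sigma>"
    and "(p, q, R) \<in> arcs n \<sigma> \<Longrightarrow> \<exists>B. arc_data n B p q R"
proof -
  obtain D0 where D0: "symmetric_diagram n \<sigma> D0" using ex_symmetric_diagram[OF \<sigma>] by blast
  have arcs: "\<exists>C\<in>D0. arc_data n (orbifold_proj ` C) p q R" if pqR: "(p, q, R) \<in> arcs n \<sigma>" for p q R
  proof -
    obtain a b where ab: "(a, b) \<in> descents n \<sigma>" "0 \<le> \<sigma> a + \<sigma> b"
      and eq: "p = \<sigma> a" "q = \<sigma> b" "R = left_values n \<sigma> a b"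
      using pqR unfolding arcs_def by blast
    show ?thesis
      by (rule symmetric_diagram_obtain[OF \<sigma> D0]) (use ab in \<open>unfold eq, blast\<close>)
  qed
  then show "(p, q, R) \<in> arcs n \<sigma> \<Longrightarrow> \<exists>B. arc_data n B p q R" by blast
  show "orbifold_diagram n \<sigma> = (\<lambda>(p, q, R). {B. arc_data n B p q R}) ` arcs n \<sigma>"
  proof (intro equalityI subsetI)
    fix A assume "A \<in> orbifold_diagram n \<sigma>"
    then obtain D C where D: "symmetric_diagram n \<sigma> D" "C \<in> D"
      and A: "A = type_B_arc_equiv n `` {orbifold_proj ` C}" by (auto simp: orbifold_diagram_def)
    obtain K where D_eq: "D = K ` descents n \<sigma>"
      and mirror: "\<And>a b. (a, b) \<in> descents n \<sigma> \<Longrightarrow> uminus ` K (a, b) = K (- b, - a)"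
      and data: "\<And>a b. \<lbrakk>(a, b) \<in> descents n \<sigma>; 0 \<le> \<sigma> a + \<sigma> b\<rbrakk> \<Longrightarrow>
        arc_data n (orbifold_proj ` K (a, b)) (\<sigma> a) (\<sigma> b) (left_values n \<sigma> a b)"
      by (fact symmetric_diagram_obtain[OF \<sigma> D(1)])
    obtain a b where ab: "(a, b) \<in> descents n \<sigma>" "C = K (a, b)" using D(2) D_eq by auto
    obtain c d where cd: "(c, d) \<in> descents n \<sigma>" "0 \<le> \<sigma> c + \<sigma> d"
      "orbifold_proj ` C = orbifold_proj ` K (c, d)"
    proof (cases "0 \<le> \<sigma> a + \<sigma> b")
      case False
      have "orbifold_proj ` C = orbifold_proj ` K (- b, - a)"
        using orbifold_proj_uminus_image[of "K (a, b)"] unfolding mirror[OF ab(1)] ab(2) by simp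
      moreover have "(- b, - a) \<in> descents n \<sigma>" using ab(1) descents_uminus[OF \<sigma>] by blast
      moreover have "0 \<le> \<sigma> (- b) + \<sigma> (- a)" using False by (simp add: signed_perms_uminus[OF \<sigma>])
      ultimately show ?thesis using that by blast
    qed (use ab that in blast)
    have "A = {B. arc_data n B (\<sigma> c) (\<sigma> d) (left_values n \<sigma> c d)}"
      unfolding A cd(3) by (rule type_B_arc_equiv_class[OF data[OF cd(1,2)]])
    then show "A \<in> (\<lambda>(p, q, R). {B. arc_data n B p q R}) ` arcs n \<sigma>"
      using cd(1,2) unfolding arcs_def by (intro image_eqI[of _ _ "(\<sigma> c, \<sigma> d, left_values n \<sigma> c d)"]) auto
  next
    fix A assume "A \<in> (\<lambda>(p, q, R). {B. arc_data n B p q R}) ` arcs n \<sigma>"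
    then obtain p q R where pqR: "(p, q, R) \<in> arcs n \<sigma>" and A: "A = {B. arc_data n B p q R}" by auto
    then obtain C where "C \<in> D0" "arc_data n (orbifold_proj ` C) p q R" using arcs by blast
    then show "A \<in> orbifold_diagram n \<sigma>"
      using D0 unfolding A orbifold_diagram_def by (auto simp: type_B_arc_equiv_class[symmetric])
  qed
qed

theorem theorem5p2:
  fixes n :: nat and \<pi> :: "int \<Rightarrow> int" and X :: "(int \<Rightarrow> int) set"
  assumes "\<pi> \<in> signed_perms n"
  shows "canonical_join_rep (weak_order n) \<pi> X \<longleftrightarrow>
    X = {j. join_irreducible n j \<and>
            (\<exists>A. orbifold_diagram n j = {A} \<and> A \<in> orbifold_diagram n \<pi>)}"
proof -
  let ?class = "\<lambda>(p, q, R). {B. arc_data n B p q R}"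
  have "(\<exists>A. orbifold_diagram n j = {A} \<and> A \<in> orbifold_diagram n \<pi>) \<longleftrightarrow> arcs n j \<subseteq> arcs n \<pi>"
    if ji: "join_irreducible n j" for j
  proof -
    have j: "j \<in> signed_perms n" using ji by (simp add: join_irreducible_def)
    obtain p q R where arc: "arcs n j = {(p, q, R)}"
      using arcs_join_irreducible_obtain[OF ji] by metis
    obtain B where B: "arc_data n B p q R" using orbifold_diagram_eq(2)[OF j] arc by blast
    have "orbifold_diagram n j = {?class (p, q, R)}"
      unfolding orbifold_diagram_eq(1)[OF j] arc by simp
    then have "(\<exists>A. orbifold_diagram n j = {A} \<and> A \<in> orbifold_diagram n \<pi>) \<longleftrightarrow>
        ?class (p, q, R) \<in> ?class ` arcs n \<pi>"
      unfolding orbifold_diagram_eq(1)[OF assms] by auto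
    \<comment> \<open>A nonempty class determines its triple, because the data of its member
      \<open>B\<close> are unique.\<close>
    also have "\<dots> \<longleftrightarrow> (p, q, R) \<in> arcs n \<pi>"
    proof
      assume "?class (p, q, R) \<in> ?class ` arcs n \<pi>"
      then obtain p' q' R' where arc': "(p', q', R') \<in> arcs n \<pi>"
        and "{B. arc_data n B p q R} = {B. arc_data n B p' q' R'}" by auto
      then have "arc_data n B p' q' R'" using B by blast
      then show "(p, q, R) \<in> arcs n \<pi>" using arc_data_unique[OF B] arc' by blast
    qed blast
    finally show ?thesis unfolding arc by simp
  qed
  then show ?thesis
    unfolding canonical_join_rep_weak_order_iff[OF assms] by (simp cong: conj_cong)
qed

end
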